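(* Let $(\Xi^n)_{n\ge 0}$ be generated by an edge iterated graph system satisfying the standing assumptions (canonical, distance-positive, degree-primitive, single-edge initial graph). Then the resistance dimension of $\Xi$ exists and satisfies $$\dim_{\mathrm R}(\Xi)=\frac{\log\rho(\Psi)}{\log\rho_{\min}(\mathcal D)}.$$
   Context: **EIGS.** Fix $K\ge1$ colours $[K]=\{1,\dots,K\}$. An edge iterated graph system (EIGS) consists of finite directed rule graphs $R_1,\dots,R_K$ whose edges are coloured by a map $\mathscr C$ with values in $[K]$, each $R_i$ having two distinct planting vertices $\beta_i^+\ne\beta_i^-$, and an initial graph $\Xi^0$, which is a single directed edge of some colour with endpoints $\mathfrak v_+,\mathfrak v_-$. Given $\Xi^n$, the graph $\Xi^{n+1}$ is obtained by simultaneously replacing every directed edge $e=(a,b)$ of colour $i$ by a fresh copy of $R_i$, identifying $a\equiv\beta_i^+$, $b\equiv\beta_i^-$, with no other identifications. Thus $V(\Xi^n)\subset V(\Xi^{n+1})$; $\Xi$ denotes the combinatorial limit with $V(\Xi)=\bigcup_nV(\Xi^n)$. Distances, degrees, paths and resistances refer to underlying undirected graphs, which are assumed simple and connected. **Matrices.** $\mathbf N\in\mathbb N^{2K\times2K}$ has rows $\kappa_{R_1}(\beta_1^+),\kappa_{R_1}(\beta_1^-),\dots,\kappa_{R_K}(\beta_K^+),\kappa_{R_K}(\beta_K^-)$, where $[\kappa_G(v)]_{2j-1}$ (resp. $[\kappa_G(v)]_{2j}$) is the number of $j$-coloured edges of $G$ leaving (resp. entering) $v$. $\mathcal D$ is the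 finite set of $K\times K$ matrices obtained by choosing, for each $i$, a simple path in $R_i$ between $\beta_i^+$ and $\beta_i^-$ and letting the $(i,j)$ entry be the number of $j$-coloured edges on the chosen path. $\rho(\cdot)$ is the spectral radius and $\rho_{\min}(\mathcal D)=\min_{D\in\mathcal D}\rho(D)$. **Resistance map.** For $\mathbf x\in(0,\infty)^K$, $[\Psi(\mathbf x)]_i$ is the effective resistance between $\beta_i^+$ and $\beta_i^-$ in $R_i$ when each $j$-coloured edge has resistance $[\mathbf x]_j$. There is a unique $\rho(\Psi)>0$ for which $\Psi(\mathbf v)=\rho(\Psi)\mathbf v$ has a solution $\mathbf v\in(0,\infty)^K$. **Standing assumptions.** (1) Canonical: every edge of every $R_i$ lies on a simple path joining $\beta_i^+$ and $\beta_i^-$. (2) Distance-positive: all matrices in $\mathcal D$ have positive entries; if $K=1$, additionally $d_{R_1}(\beta_1^+,\beta_1^-)\ge2$. (3) $\mathbf N$ is primitive. (4) $\Xi^0$ is a single edge. **Resistance dimension.** $\mathscr R_{G}(u,w)$ is the effective resistance between $u$ and $w$ in $G$ with unit resistance on every edge. If for every pair of distinct $u,w\in V(\Xi^0)$ the limit $\dim_{\mathrm R}(\Xi):=\lim_{n\to\infty}\frac{\log\mathscr R_{\Xi^n}(u,w)}{\log d_{\Xi^n}(u,w)}$ exists and does not depend on $u,w$, it is called the resistance dimension of $\Xi$. *)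

theory Defs
  imports Complex_Main "Graph_Theory.Digraph_Component" "Jordan_Normal_Form.Spectral_Radius"
begin

section \<open>Underlying undirected graphs\<close>

abbreviation und :: "('a, 'b) pre_digraph \<Rightarrow> ('a, 'a \<times> 'a) pre_digraph" where
  "und G \<equiv> with_proj (mk_symmetric G)"

text \<open>Asymmetry of the arc relation rules out antiparallel arcs, so that (together with
  \<^const>\<open>digraph\<close>: finite, no loops, no parallel arcs) the underlying undirected graph is
  simple. The \<open>connected\<close> of \<^theory>\<open>Graph_Theory.Digraph_Component\<close> is connectedness of the
  underlying undirected graph.\<close>

definition simple_connected :: "('a, 'b) pre_digraph \<Rightarrow> bool" where
  "simple_connected G \<longleftrightarrow>
     digraph G \<and> asym (arcs_ends G) \<and> Digraph_Component.connected G"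

definition simple_path :: "('a, 'b) pre_digraph \<Rightarrow> 'a \<Rightarrow> ('a \<times> 'a) list \<Rightarrow> 'a \<Rightarrow> bool" where
  "simple_path G u p v \<longleftrightarrow> pre_digraph.apath (und G) u p v"

text \<open>Paths live in the underlying undirected graph, so an arc may be traversed in either
  direction.\<close>

definition path_arcs :: "('a, 'b) pre_digraph \<Rightarrow> ('a \<times> 'a) list \<Rightarrow> 'b set" where
  "path_arcs G p =
     {e \<in> arcs G. (tail G e, head G e) \<in> set p \<or> (head G e, tail G e) \<in> set p}"

definition graph_dist :: "('a, 'b) pre_digraph \<Rightarrow> 'a \<Rightarrow> 'a \<Rightarrow> nat" where
  "graph_dist G u v = (LEAST k. \<exists>p. pre_digraph.awalk (und G) u p v \<and> length p = k)"


section \<open>Effective resistance\<close>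

text \<open>\<open>unit_potential G r u w \<phi>\<close>: if the arc \<open>e\<close> has resistance \<open>r e\<close>, then by Ohm's law the
  potential \<open>\<phi>\<close> drives a current satisfying Kirchhoff's current law, where a unit current is
  injected at \<open>u\<close> and extracted at \<open>w\<close>. The left-hand side is the net current out of \<open>x\<close>.\<close>

definition unit_potential ::
  "('a, 'b) pre_digraph \<Rightarrow> ('b \<Rightarrow> real) \<Rightarrow> 'a \<Rightarrow> 'a \<Rightarrow> ('a \<Rightarrow> real) \<Rightarrow> bool" where
  "unit_potential G r u w \<phi> \<longleftrightarrow>
     (\<forall>x \<in> verts G.
        (\<Sum>e | e \<in> arcs G \<and> tail G e = x. (\<phi> x - \<phi> (head G e)) / r e) +
        (\<Sum>e | e \<in> arcs G \<and> head G e = x. (\<phi> x - \<phi> (tail G e)) / r e)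
        = of_bool (x = u) - of_bool (x = w))"

definition eff_res :: "('a, 'b) pre_digraph \<Rightarrow> ('b \<Rightarrow> real) \<Rightarrow> 'a \<Rightarrow> 'a \<Rightarrow> real" where
  "eff_res G r u w = (THE R. \<exists>\<phi>. unit_potential G r u w \<phi> \<and> R = \<phi> u - \<phi> w)"


section \<open>Edge iterated graph systems\<close>

text \<open>The \<open>K = num_cols S\<close> colours are \<open>0, \<dots>, K - 1\<close>, in accordance with the indexing of matrices.
  The rule graphs may share arc names, so the colouring \<open>ecol\<close> takes the index of the rule graph
  as an additional argument. The initial graph is a single arc, hence given by its colour.\<close>

record ('v, 'e) eigs =
  num_cols :: nat
  rule :: "nat \<Rightarrow> ('v, 'e) pre_digraph"
  ecol :: "nat \<Rightarrow> 'e \<Rightarrow> nat"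
  plant_pos :: "nat \<Rightarrow> 'v"
  plant_neg :: "nat \<Rightarrow> 'v"
  init_col :: nat

definition wf_eigs :: "('v, 'e) eigs \<Rightarrow> bool" where
  "wf_eigs S \<longleftrightarrow>
     1 \<le> num_cols S \<and> init_col S < num_cols S \<and>
     (\<forall>i < num_cols S.
        simple_connected (rule S i) \<and>
        ecol S i ` arcs (rule S i) \<subseteq> {..<num_cols S} \<and>
        plant_pos S i \<in> verts (rule S i) \<and> plant_neg S i \<in> verts (rule S i) \<and>
        plant_pos S i \<noteq> plant_neg S i)"

text \<open>An arc of the \<open>n\<close>-th graph \<open>Xi S n\<close> is named by a list of length \<open>n\<close>, most recent choice
  first: \<open>f # e\<close> is the copy of the rule arc \<open>f\<close> in the copy of the rule graph that replaces the arc
  \<open>e\<close> of the previous graph, and \<open>[]\<close> is the initial arc, directed from \<open>V_pos\<close> to \<open>V_neg\<close>.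
  The vertex \<open>V_new e x\<close> is the copy of the non-planting vertex \<open>x\<close> in the rule graph replacing \<open>e\<close>.
  Thus \<open>verts (Xi S n) \<subseteq> verts (Xi S (Suc n))\<close> holds literally.\<close>

datatype ('v, 'e) xvert = V_pos | V_neg | V_new "'e list" 'v

primrec acol :: "('v, 'e) eigs \<Rightarrow> 'e list \<Rightarrow> nat" where
  "acol S [] = init_col S"
| "acol S (f # e) = ecol S (acol S e) f"

text \<open>The vertex that the vertex \<open>x\<close> of the rule graph replacing an arc \<open>e\<close> from \<open>a\<close> to \<open>b\<close> becomes
  after the identification of \<open>a\<close> and \<open>b\<close> with the planting vertices.\<close>

definition embed ::
  "('v, 'e) eigs \<Rightarrow> 'e list \<Rightarrow> ('v, 'e) xvert \<Rightarrow> ('v, 'e) xvert \<Rightarrow> 'v \<Rightarrow> ('v, 'e) xvert" where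
  "embed S e a b x =
     (if x = plant_pos S (acol S e) then a
      else if x = plant_neg S (acol S e) then b
      else V_new e x)"

definition substitute ::
  "('v, 'e) eigs \<Rightarrow> (('v, 'e) xvert, 'e list) pre_digraph \<Rightarrow> (('v, 'e) xvert, 'e list) pre_digraph"
where
  "substitute S G =
     \<lparr> verts = verts G \<union>
         {V_new e x | e x. e \<in> arcs G \<and>
            x \<in> verts (rule S (acol S e)) - {plant_pos S (acol S e), plant_neg S (acol S e)}},
       arcs = {f # e | f e. e \<in> arcs G \<and> f \<in> arcs (rule S (acol S e))},
       tail = (\<lambda>d. case d of f # e \<Rightarrow>
         embed S e (tail G e) (head G e) (tail (rule S (acol S e)) f)),
       head = (\<lambda>d. case d of f # e \<Rightarrow>
         embed S e (tail G e) (head G e) (head (rule S (acol S e)) f)) \<rparr>"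

primrec Xi :: "('v, 'e) eigs \<Rightarrow> nat \<Rightarrow> (('v, 'e) xvert, 'e list) pre_digraph" where
  "Xi S 0 = \<lparr> verts = {V_pos, V_neg}, arcs = {[]}, tail = (\<lambda>_. V_pos), head = (\<lambda>_. V_neg) \<rparr>"
| "Xi S (Suc n) = substitute S (Xi S n)"


section \<open>Matrices\<close>

text \<open>With indices from \<open>0\<close>, rows \<open>2 * i\<close> and \<open>2 * i + 1\<close> of the degree matrix belong to the positive
  and negative planting vertex of rule graph \<open>i\<close>, and columns \<open>2 * j\<close> and \<open>2 * j + 1\<close> to the arcs of
  colour \<open>j\<close> leaving and entering.\<close>

definition kappa :: "('v, 'e) eigs \<Rightarrow> nat \<Rightarrow> 'v \<Rightarrow> nat \<Rightarrow> nat" where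
  "kappa S i v c =
     (if even c
      then card {e \<in> arcs (rule S i). ecol S i e = c div 2 \<and> tail (rule S i) e = v}
      else card {e \<in> arcs (rule S i). ecol S i e = c div 2 \<and> head (rule S i) e = v})"

definition degree_matrix :: "('v, 'e) eigs \<Rightarrow> nat mat" where
  "degree_matrix S = mat (2 * num_cols S) (2 * num_cols S)
     (\<lambda>(r, c). kappa S (r div 2)
        (if even r then plant_pos S (r div 2) else plant_neg S (r div 2)) c)"

definition primitive_mat :: "nat mat \<Rightarrow> bool" where
  "primitive_mat A \<longleftrightarrow>
     (\<exists>m \<ge> 1. \<forall>i < dim_row A. \<forall>j < dim_col A. 0 < (A ^\<^sub>m m) $$ (i, j))"

definition distance_matrices :: "('v, 'e) eigs \<Rightarrow> nat mat set" where
  "distance_matrices S =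
     {mat (num_cols S) (num_cols S)
        (\<lambda>(i, j). card {e \<in> path_arcs (rule S i) (p i). ecol S i e = j}) | p.
      \<forall>i < num_cols S. simple_path (rule S i) (plant_pos S i) (p i) (plant_neg S i)}"

definition rho_min :: "nat mat set \<Rightarrow> real" where
  "rho_min \<D> = Min ((\<lambda>D. spectral_radius (map_mat of_nat D)) ` \<D>)"


section \<open>Resistance map\<close>

definition Psi :: "('v, 'e) eigs \<Rightarrow> real vec \<Rightarrow> real vec" where
  "Psi S x = vec (num_cols S)
     (\<lambda>i. eff_res (rule S i) (\<lambda>e. x $ ecol S i e) (plant_pos S i) (plant_neg S i))"

definition rho_Psi :: "('v, 'e) eigs \<Rightarrow> real" where
  "rho_Psi S = (THE \<rho>. 0 < \<rho> \<and>
     (\<exists>v \<in> carrier_vec (num_cols S). (\<forall>i < num_cols S. 0 < v $ i) \<and> Psi S v = \<rho> \<cdot>\<^sub>v v))"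


section \<open>Standing assumptions\<close>

definition canonical :: "('v, 'e) eigs \<Rightarrow> bool" where
  "canonical S \<longleftrightarrow>
     (\<forall>i < num_cols S. \<forall>e \<in> arcs (rule S i). \<exists>p.
        simple_path (rule S i) (plant_pos S i) p (plant_neg S i) \<and> e \<in> path_arcs (rule S i) p)"

definition distance_positive :: "('v, 'e) eigs \<Rightarrow> bool" where
  "distance_positive S \<longleftrightarrow>
     (\<forall>D \<in> distance_matrices S. \<forall>i < num_cols S. \<forall>j < num_cols S. 0 < D $$ (i, j)) \<and>
     (num_cols S = 1 \<longrightarrow> 2 \<le> graph_dist (rule S 0) (plant_pos S 0) (plant_neg S 0))"

definition degree_primitive :: "('v, 'e) eigs \<Rightarrow> bool" where
  "degree_primitive S \<longleftrightarrow> primitive_mat (degree_matrix S)"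


section \<open>Resistance dimension\<close>

definition has_resistance_dim :: "('v, 'e) eigs \<Rightarrow> real \<Rightarrow> bool" where
  "has_resistance_dim S c \<longleftrightarrow>
     (\<forall>u \<in> verts (Xi S 0). \<forall>w \<in> verts (Xi S 0). u \<noteq> w \<longrightarrow>
        (\<lambda>n. ln (eff_res (Xi S n) (\<lambda>_. 1) u w) / ln (real (graph_dist (Xi S n) u w)))
          \<longlonglongrightarrow> c)"

definition resistance_dim :: "('v, 'e) eigs \<Rightarrow> real" where
  "resistance_dim S = (THE c. has_resistance_dim S c)"

end

theory Submission
  imports Defs
begin

text \<open>Let \<open>F\<close> be either the resistance map \<open>\<Psi>\<close> or the map sending a vector of edge lengths to the lengths of
  the shortest paths between the planting vertices, that is, the minimum of \<open>D x\<close> over the distance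
  matrices \<open>D\<close>. Substitution shows that the resistance and the distance between the endpoints of the
  \<open>n\<close>-th graph are the initial coordinate of the \<open>n\<close>-th iterate of \<open>F\<close> at \<open>(1, \<dots>, 1)\<close>: potentials and
  Lipschitz functions extend to, and walks lift to, the copies of the rule graphs. As every path between
  planting vertices meets every colour, \<open>F\<close> is homogeneous, strictly monotone and satisfies
  \<open>c x\<^sub>j \<le> F(x)\<^sub>i\<close>. Minimising \<open>max\<^sub>i F(x)\<^sub>i / x\<^sub>i\<close> over the positive cone then yields a positive
  eigenvector, whose eigenvalue is the exponential growth rate of the iterates. For the distance map this
  eigenvalue is \<open>\<rho>\<^sub>m\<^sub>i\<^sub>n\<close>, by comparison with the positive eigenvectors of the distance matrices.\<close>

section \<open>Homogeneous monotone maps of the positive cone\<close>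

text \<open>Strict monotonicity turns the attained inequality into an eigenvector equation.
  Resistances and distances are computed exactly. For resistance one weak potential suffices, as any
  two have the same drop; for distance a walk gives the upper bound and a Lipschitz function, the
  dual certificate, the lower one. To make this iterate, arcs carry arbitrary positive colour
  weights \<open>x\<close>: one substitution trades \<open>x\<close> on the finer graph for
  \<open>F x\<close> on the coarser one. A colour met by every path contains a cut between the
  planting vertices, whence the lower bound and strictness for resistance. The minimum over matrices
  is a single map because rows are chosen independently, so that at a given vector one matrix
  minimises every coordinate.\<close>

lemma convergent_subsequence_finite_index:
  fixes x :: "nat \<Rightarrow> nat \<Rightarrow> real"
  assumes "\<And>n k. k < K \<Longrightarrow> a \<le> x n k \<and> x n k \<le> b"
  shows "\<exists>s. strict_mono s \<and> (\<forall>k<K. convergent (\<lambda>n. x (s n) k))"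
  using assms
proof (induction K)
  case 0
  then show ?case using strict_mono_id by blast
next
  case (Suc K)
  then obtain s where s: "strict_mono s" "\<And>k. k < K \<Longrightarrow> convergent (\<lambda>n. x (s n) k)"
    by (metis less_SucI)
  obtain f where f: "strict_mono f" "monoseq (\<lambda>n. x (s (f n)) K)"
    using seq_monosub[of "\<lambda>n. x (s n) K"] by auto
  have "Bseq (\<lambda>n. x (s (f n)) K)"
    using Suc.prems by (intro BseqI'[of _ "\<bar>a\<bar> + \<bar>b\<bar>"]) (smt (verit) lessI real_norm_def)
  then have "convergent (\<lambda>n. x (s (f n)) K)"
    using f by (simp add: Bseq_monoseq_convergent)
  moreover have "convergent (\<lambda>n. x (s (f n)) k)" if "k < K" for k
    using convergent_subseq_convergent[OF s(2)[OF that] f(1)] by (simp add: o_def)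
  ultimately show ?case
    using strict_mono_o[OF s(1) f(1)] by (intro exI[of _ "s \<circ> f"]) (auto simp: less_Suc_eq o_def)
qed

text \<open>\<open>t\<close> is the largest ratio \<open>x k / y k\<close>, so \<open>t * y\<close>
  is the least multiple of \<open>y\<close> dominating \<open>x\<close>. Eigenvalues are compared at
  the contact coordinate \<open>i\<close>.\<close>

lemma tight_ratio_bound:
  fixes x y :: "nat \<Rightarrow> real"
  assumes "0 < K" "\<forall>k<K. 0 < y k"
  shows "\<exists>t i. i < K \<and> x i = t * y i \<and> (\<forall>k<K. x k \<le> t * y k)"
proof -
  let ?R = "(\<lambda>k. x k / y k) ` {..<K}"
  have "Max ?R \<in> ?R" using assms(1) by (intro Max_in) auto
  then obtain i where i: "i < K" "Max ?R = x i / y i" by auto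
  have "x k / y k \<le> Max ?R" if "k < K" for k using that by auto
  with i have "x k \<le> x i / y i * y k" if "k < K" for k
    using that assms(2) by (metis pos_divide_le_eq)
  moreover have "x i = x i / y i * y i" using assms(2) i(1) by (metis less_irrefl nonzero_eq_divide_eq)
  ultimately show ?thesis using i(1) by blast
qed

text \<open>Vectors are functions on \<open>nat\<close> of which only the coordinates below
  \<open>K\<close> count: by \<open>mono\<close> in both directions, \<open>F\<close> ignores the
  others at positive arguments. \<open>lower\<close> is a quantitative form of
  irreducibility.\<close>

locale cone_map =
  fixes K :: nat and F :: "(nat \<Rightarrow> real) \<Rightarrow> nat \<Rightarrow> real" and c :: real
  assumes K_pos: "0 < K"
    and c_pos: "0 < c"
    and hom: "\<And>t x i. 0 < t \<Longrightarrow> (\<And>k. k < K \<Longrightarrow> 0 < x k) \<Longrightarrow> i < K \<Longrightarrow>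
      F (\<lambda>k. t * x k) i = t * F x i"
    and mono: "\<And>x y i. (\<And>k. k < K \<Longrightarrow> 0 < x k) \<Longrightarrow> (\<And>k. k < K \<Longrightarrow> x k \<le> y k) \<Longrightarrow> i < K \<Longrightarrow>
      F x i \<le> F y i"
    and strict: "\<And>x y i j. (\<And>k. k < K \<Longrightarrow> 0 < x k) \<Longrightarrow> (\<And>k. k < K \<Longrightarrow> x k \<le> y k) \<Longrightarrow>
      j < K \<Longrightarrow> x j < y j \<Longrightarrow> i < K \<Longrightarrow> F x i < F y i"
    and lower: "\<And>x i j. (\<And>k. k < K \<Longrightarrow> 0 < x k) \<Longrightarrow> i < K \<Longrightarrow> j < K \<Longrightarrow> c * x j \<le> F x i"
begin

lemma pos: "(\<And>k. k < K \<Longrightarrow> 0 < x k) \<Longrightarrow> i < K \<Longrightarrow> 0 < F x i"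
  using lower[of x i i] c_pos by (metis less_le_trans mult_pos_pos)

text \<open>Where \<open>t * y\<close> touches \<open>x\<close> from above, \<open>\<alpha> * x i
  \<le> F x i \<le> t * F y i \<le> \<beta> * x i\<close>. Applied both ways this makes the positive
  eigenvalue unique; with a mere sub-eigenvector it compares the eigenvalues of different
  maps.\<close>

lemma sub_super_eigenvalue_le:
  assumes x: "\<And>k. k < K \<Longrightarrow> 0 < x k" "\<And>k. k < K \<Longrightarrow> \<alpha> * x k \<le> F x k"
    and y: "\<And>k. k < K \<Longrightarrow> 0 < y k" "\<And>k. k < K \<Longrightarrow> F y k \<le> \<beta> * y k"
  shows "\<alpha> \<le> \<beta>"
proof -
  have "\<forall>k<K. 0 < y k" using y(1) by simp
  from tight_ratio_bound[OF K_pos this, of x] obtain t i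
    where t: "i < K" "x i = t * y i"
      "\<And>k. k < K \<Longrightarrow> x k \<le> t * y k"
    by blast
  have t0: "0 < t" using x(1)[OF t(1)] y(1)[OF t(1)] t(2) by (simp add: zero_less_mult_iff)
  have "\<alpha> * x i \<le> F x i" using x(2) t(1) by blast
  also have "\<dots> \<le> F (\<lambda>k. t * y k) i" using x(1) t by (intro mono) auto
  also have "\<dots> = t * F y i" using t0 y(1) t(1) by (intro hom) auto
  also have "\<dots> \<le> t * (\<beta> * y i)" using t0 y(2)[OF t(1)] by simp
  also have "\<dots> = \<beta> * x i" using t(2) by simp
  finally show ?thesis using x(1)[OF t(1)] by simp
qed

lemma ex_eigenvector:
  obtains \<rho> x where "0 < \<rho>" "\<And>k. k < K \<Longrightarrow> 0 < x k" "\<And>k. k < K \<Longrightarrow> F x k = \<rho> * x k"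
proof -
  \<comment> \<open>The infimum of \<open>T\<close> is the Collatz-Wielandt number of
    \<open>F\<close>; \<open>lower\<close> on the diagonal bounds it below by
    \<open>c\<close>.\<close>
  define T where "T = {t. \<exists>x. (\<forall>k<K. 0 < x k) \<and> (\<forall>k<K. F x k \<le> t * x k)}"
  have T_ge: "c \<le> t" if "t \<in> T" for t
    using that lower[of _ 0 0] K_pos unfolding T_def
    by (smt (verit) mem_Collect_eq mult_le_cancel_right_pos)
  \<comment> \<open>Among finitely many coordinates the largest ratio is attained, so strict
    inequality everywhere leaves room for a factor strictly below \<open>\<beta>\<close>. This is
    what contradicts minimality at the end.\<close>
  have T_I: "\<exists>t\<in>T. t < \<beta>" if "\<And>k. k < K \<Longrightarrow> 0 < y k" "\<And>k. k < K \<Longrightarrow> F y k < \<beta> * y k" for y \<beta>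
  proof -
    have "\<forall>k<K. 0 < y k" using that(1) by simp
    from tight_ratio_bound[OF K_pos this, of "F y"] obtain t i
      where t: "i < K" "F y i = t * y i"
        "\<And>k. k < K \<Longrightarrow> F y k \<le> t * y k"
      by blast
    then have "t \<in> T" using that(1) by (auto simp: T_def)
    moreover have "t < \<beta>" using that(1)[OF t(1)] that(2)[OF t(1)] t(2) by simp
    ultimately show ?thesis by blast
  qed
  obtain t1 where "t1 \<in> T"
  proof -
    have "\<forall>k<K. 0 < (1::real)" by simp
    from tight_ratio_bound[OF K_pos this, of "F (\<lambda>_. 1)"] obtain t i
      where t: "i < K" "F (\<lambda>_. 1) i = t * 1"
        "\<And>k. k < K \<Longrightarrow> F (\<lambda>_. 1) k \<le> t * 1"
      by blast
    then have "t \<in> T" unfolding T_def by (auto intro!: exI[of _ "\<lambda>_. 1"])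
    then show thesis by (rule that)
  qed
  have bdd: "bdd_below T" using T_ge by (meson bdd_below.I)
  define \<rho> where "\<rho> = Inf T"
  have \<rho>_le: "\<rho> \<le> t" if "t \<in> T" for t unfolding \<rho>_def using that bdd by (rule cInf_lower)
  have \<rho>_pos: "0 < \<rho>"
    using cInf_greatest[of T c] T_ge \<open>t1 \<in> T\<close> c_pos unfolding \<rho>_def by fastforce
  \<comment> \<open>Near-minimisers are scaled to have largest coordinate 1. With \<open>M\<close>
    the largest coordinate before scaling, \<open>c * M \<le> F x k \<le> t * x k\<close> and
    \<open>t \<le> \<rho> + 1\<close> give the lower bound, hence a compact box inside the open
    cone.\<close>
  have "\<exists>t z. \<rho> \<le> t \<and> t < \<rho> + 1 / Suc n \<and>
      (\<forall>k<K. c / (\<rho> + 1) \<le> z k \<and> z k \<le> 1 \<and> F z k \<le> t * z k)" for n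
  proof -
    obtain t where t: "t \<in> T" "t < \<rho> + 1 / Suc n"
      using cInf_lessD[of T "\<rho> + 1 / Suc n"] \<open>t1 \<in> T\<close> unfolding \<rho>_def by auto
    have "1 / real (Suc n) \<le> 1" by simp
    with t have t': "0 < t" "t \<le> \<rho> + 1" using T_ge[OF t(1)] c_pos by linarith+
    obtain x where x: "\<And>k. k < K \<Longrightarrow> 0 < x k" "\<And>k. k < K \<Longrightarrow> F x k \<le> t * x k"
      using t(1) by (auto simp: T_def)
    have "\<forall>k<K. 0 < (1::real)" by simp
    from tight_ratio_bound[OF K_pos this, of x] obtain M i
      where M: "i < K" "x i = M * 1"
        "\<And>k. k < K \<Longrightarrow> x k \<le> M * 1"
      by blast
    have M0: "0 < M" using M(1,2) x(1) by fastforce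
    define z where "z k = 1 / M * x k" for k
    have "F z k \<le> t * z k" if "k < K" for k
    proof -
      have "F z k = 1 / M * F x k" unfolding z_def using M0 x(1) that by (intro hom) auto
      then show ?thesis using M0 x(2)[OF that] by (simp add: z_def divide_simps)
    qed
    moreover have "z k \<le> 1" if "k < K" for k using M(3)[OF that] M0 by (simp add: z_def divide_simps)
    moreover have "c / (\<rho> + 1) \<le> z k" if "k < K" for k
    proof -
      have "c * M \<le> t * x k" using lower[of x k i] x M that by force
      also have "\<dots> \<le> (\<rho> + 1) * x k" using t' x(1)[OF that] by simp
      finally show ?thesis using M0 \<rho>_pos by (simp add: z_def divide_simps mult.commute)
    qed
    ultimately show ?thesis using t(2) \<rho>_le[OF t(1)] by blast
  qed
  then obtain t z where tz: "\<And>n. \<rho> \<le> t n" "\<And>n. t n < \<rho> + 1 / Suc n"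
      "\<And>n k. k < K \<Longrightarrow> c / (\<rho> + 1) \<le> z n k \<and> z n k \<le> 1"
      "\<And>n k. k < K \<Longrightarrow> F (z n) k \<le> t n * z n k"
    by metis
  have t_lim: "t \<longlonglongrightarrow> \<rho>"
  proof (rule tendsto_sandwich[OF _ _ tendsto_const])
    show "(\<lambda>n. \<rho> + 1 / Suc n) \<longlonglongrightarrow> \<rho>"
      using tendsto_add[OF tendsto_const LIMSEQ_inverse_real_of_nat, of \<rho>] by (simp add: field_simps)
  qed (use tz(1,2) in \<open>auto intro!: always_eventually less_imp_le\<close>)
  obtain s where s: "strict_mono s" "\<And>k. k < K \<Longrightarrow> convergent (\<lambda>n. z (s n) k)"
    using convergent_subsequence_finite_index[of K _ z, OF tz(3)] by blast
  define x where "x k = lim (\<lambda>n. z (s n) k)" for k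
  have x_lim: "(\<lambda>n. z (s n) k) \<longlonglongrightarrow> x k" if "k < K" for k
    using s(2)[OF that] by (simp add: x_def convergent_LIMSEQ_iff)
  have ts_lim: "(\<lambda>n. t (s n)) \<longlonglongrightarrow> \<rho>" using LIMSEQ_subseq_LIMSEQ[OF t_lim s(1)] by (simp add: o_def)
  have x_pos: "0 < x k" if "k < K" for k
  proof -
    have "c / (\<rho> + 1) \<le> x k" using x_lim[OF that] tz(3)[OF that] by (intro LIMSEQ_le_const) auto
    then show ?thesis using c_pos \<rho>_pos by (smt (verit) divide_pos_pos)
  qed
  have sup: "F x i \<le> \<rho> * x i" if i: "i < K" for i
  proof -
    \<comment> \<open>Eventually \<open>z (s n)\<close> dominates
      \<open>(1 - \<epsilon>) * x\<close>, so homogeneity and monotonicity carry the inequality to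
      the limit at the price of a factor \<open>1 - \<epsilon>\<close>, which is then
      removed.\<close>
    have "(1 - \<epsilon>) * F x i \<le> \<rho> * x i" if \<epsilon>: "0 < \<epsilon>" "\<epsilon> < 1" for \<epsilon>
    proof -
      have "\<forall>\<^sub>F n in sequentially. \<forall>k\<in>{..<K}. (1 - \<epsilon>) * x k \<le> z (s n) k"
      proof (rule eventually_ball_finite)
        show "\<forall>k\<in>{..<K}. \<forall>\<^sub>F n in sequentially. (1 - \<epsilon>) * x k \<le> z (s n) k"
        proof
          fix k assume "k \<in> {..<K}"
          then have k: "k < K" by simp
          have "(1 - \<epsilon>) * x k < x k" using x_pos[OF k] \<epsilon> by simp
          then show "\<forall>\<^sub>F n in sequentially. (1 - \<epsilon>) * x k \<le> z (s n) k"
            using order_tendstoD(1)[OF x_lim[OF k]] by (blast intro: eventually_mono less_imp_le)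
        qed
      qed simp
      then have "\<forall>\<^sub>F n in sequentially. (1 - \<epsilon>) * F x i \<le> t (s n) * z (s n) i"
      proof eventually_elim
        case (elim n)
        have "(1 - \<epsilon>) * F x i = F (\<lambda>k. (1 - \<epsilon>) * x k) i" using \<epsilon> x_pos i by (intro hom[symmetric]) auto
        also have "\<dots> \<le> F (z (s n)) i" using elim \<epsilon> x_pos i by (intro mono) auto
        also have "\<dots> \<le> t (s n) * z (s n) i" using tz(4) i by blast
        finally show ?case .
      qed
      moreover have "(\<lambda>n. t (s n) * z (s n) i) \<longlonglongrightarrow> \<rho> * x i"
        by (intro tendsto_mult ts_lim x_lim i)
      ultimately show ?thesis by (intro tendsto_lowerbound[of _ _ sequentially]) auto
    qed
    then have "\<forall>\<^sub>F \<epsilon> in at_right 0. (1 - \<epsilon>) * F x i \<le> \<rho> * x i"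
      unfolding eventually_at_right_field by (intro exI[of _ 1]) auto
    moreover have "((\<lambda>\<epsilon>. (1 - \<epsilon>) * F x i) \<longlongrightarrow> (1 - 0) * F x i) (at_right 0)"
      by (intro tendsto_intros)
    ultimately show ?thesis
      using tendsto_upperbound[of "\<lambda>\<epsilon>. (1 - \<epsilon>) * F x i" _ "at_right 0"] by simp
  qed
  have "F x i = \<rho> * x i" if i: "i < K" for i
  proof (rule ccontr)
    assume "F x i \<noteq> \<rho> * x i"
    then have lt: "F x i < \<rho> * x i" using sup[OF i] by simp
    \<comment> \<open>One more application of \<open>F\<close> spreads strictness from the
      coordinate \<open>i\<close> to all coordinates, so \<open>F x\<close> admits a factor below
      \<open>\<rho>\<close>.\<close>
    have "F (F x) k < \<rho> * F x k" if "k < K" for k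
    proof -
      have "F (F x) k < F (\<lambda>k. \<rho> * x k) k"
        using i lt that by (intro strict[of "F x" "\<lambda>k. \<rho> * x k" i]) (auto intro: pos x_pos sup)
      also have "\<dots> = \<rho> * F x k" using \<rho>_pos x_pos that by (intro hom) auto
      finally show ?thesis .
    qed
    then obtain t where "t \<in> T" "t < \<rho>" using T_I[of "F x" \<rho>] pos x_pos by blast
    then show False using \<rho>_le by fastforce
  qed
  then show thesis using that \<rho>_pos x_pos by blast
qed

lemma funpow_pos: "(\<And>k. k < K \<Longrightarrow> 0 < x k) \<Longrightarrow> i < K \<Longrightarrow> 0 < (F ^^ n) x i"
  by (induction n arbitrary: i) (auto intro: pos)

lemma funpow_mono:
  assumes "\<And>k. k < K \<Longrightarrow> 0 < x k" "\<And>k. k < K \<Longrightarrow> x k \<le> y k" "i < K"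
  shows "(F ^^ n) x i \<le> (F ^^ n) y i"
  using assms(3) by (induction n arbitrary: i) (auto intro!: mono funpow_pos assms)

lemma funpow_eigenvector:
  assumes "0 < \<rho>" "\<And>k. k < K \<Longrightarrow> 0 < x k" "\<And>k. k < K \<Longrightarrow> F x k = \<rho> * x k" "0 < t" "i < K"
  shows "(F ^^ n) (\<lambda>k. t * x k) i = t * \<rho> ^ n * x i"
  using assms(5)
proof (induction n arbitrary: i)
  case (Suc n)
  let ?s = "t * \<rho> ^ n" and ?z = "(F ^^ n) (\<lambda>k. t * x k)"
  have s: "0 < ?s" using assms by simp
  then have z: "0 < ?z k" "?z k = ?s * x k" if "k < K" for k using Suc.IH[OF that] assms(2)[OF that] by simp_all
  \<comment> \<open>The iterate is a multiple of \<open>x\<close> only on coordinates below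
    \<open>K\<close>, so the images agree by monotonicity in both directions, not by
    congruence.\<close>
  have "F ?z i = F (\<lambda>k. ?s * x k) i"
    using z s assms(2) Suc.prems by (intro antisym mono) auto
  also have "\<dots> = ?s * F x i" using s assms(2) Suc.prems by (intro hom) auto
  finally show ?case using assms(3)[OF Suc.prems] by simp
qed simp

text \<open>The vector of ones lies between two multiples of the eigenvector, \<open>1 / t\<close>
  and \<open>t'\<close> being the inverses of its largest and smallest coordinate. The iterates then
  lie between constants times \<open>\<rho> ^ n\<close>, and the constants vanish after taking
  \<open>ln\<close> and dividing by \<open>n\<close>.\<close>

lemma funpow_growth:
  assumes "0 < \<rho>" "\<And>k. k < K \<Longrightarrow> 0 < x k" "\<And>k. k < K \<Longrightarrow> F x k = \<rho> * x k" "i < K"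
  shows "(\<lambda>n. ln ((F ^^ n) (\<lambda>_. 1) i) / n) \<longlonglongrightarrow> ln \<rho>"
proof -
  have "\<forall>k<K. 0 < (1::real)" by simp
  from tight_ratio_bound[OF K_pos this, of x] obtain t i1
    where t: "i1 < K" "x i1 = t * 1"
      "\<And>k. k < K \<Longrightarrow> x k \<le> t * 1"
    by blast
  have "\<forall>k<K. 0 < x k" using assms(2) by simp
  from tight_ratio_bound[OF K_pos this, of "\<lambda>_. 1"] obtain t' i2
    where t': "i2 < K" "1 = t' * x i2" "\<And>k. k < K \<Longrightarrow> 1 \<le> t' * x k"
    by blast
  have t0: "0 < t" using assms(2)[OF t(1)] t(2) by simp
  have t'0: "0 < t'" using assms(2)[OF t'(1)] t'(2) zero_less_mult_pos2[of t' "x i2"] by simp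
  note x = assms(1-3) and xi = assms(2)[OF assms(4)]
  let ?a = "\<lambda>n. (F ^^ n) (\<lambda>_. 1) i"
  have lo: "1 / t * x i * \<rho> ^ n \<le> ?a n" for n
  proof -
    have "(F ^^ n) (\<lambda>k. 1 / t * x k) i \<le> ?a n"
      using t0 t(3) assms by (intro funpow_mono) auto
    moreover have "(F ^^ n) (\<lambda>k. 1 / t * x k) i = 1 / t * \<rho> ^ n * x i"
      using t0 assms by (intro funpow_eigenvector) auto
    ultimately show ?thesis by (simp add: mult_ac)
  qed
  have hi: "?a n \<le> t' * x i * \<rho> ^ n" for n
    using funpow_eigenvector[OF x, of t' i n]
      funpow_mono[of "\<lambda>_. 1" "\<lambda>k. t' * x k" i n] t'0 t'(3) assms by (simp add: field_simps)
  have *: "(\<lambda>n. ln (q * \<rho> ^ n) / n) \<longlonglongrightarrow> ln \<rho>" if "0 < q" for q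
  proof (rule Lim_transform_eventually)
    show "(\<lambda>n. ln q * inverse (real n) + ln \<rho>) \<longlonglongrightarrow> ln \<rho>"
      using tendsto_add[OF tendsto_mult[OF tendsto_const lim_inverse_n] tendsto_const, of "ln q" "ln \<rho>"] by simp
    show "\<forall>\<^sub>F n in sequentially. ln q * inverse (real n) + ln \<rho> = ln (q * \<rho> ^ n) / n"
      using eventually_gt_at_top[of 0]
      by eventually_elim (use that assms(1) in \<open>simp add: ln_mult ln_realpow field_simps\<close>)
  qed
  have q: "0 < 1 / t * x i" "0 < t' * x i" using t0 t'0 xi by simp_all
  show ?thesis
  proof (rule tendsto_sandwich[OF _ _ *[OF q(1)] *[OF q(2)]])
    have a_pos: "0 < ?a n" for n using funpow_pos assms(4) by simp
    have "ln (1 / t * x i * \<rho> ^ n) \<le> ln (?a n)" for n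
      using lo[of n] mult_pos_pos[OF q(1) zero_less_power[OF assms(1)]] by (simp only: ln_le_cancel_iff a_pos)
    then show "\<forall>\<^sub>F n in sequentially. ln (1 / t * x i * \<rho> ^ n) / n \<le> ln (?a n) / n"
      by (intro always_eventually allI divide_right_mono) auto
    have "ln (?a n) \<le> ln (t' * x i * \<rho> ^ n)" for n
      using hi[of n] mult_pos_pos[OF q(2) zero_less_power[OF assms(1)]] by (simp only: ln_le_cancel_iff a_pos)
    then show "\<forall>\<^sub>F n in sequentially. ln (?a n) / n \<le> ln (t' * x i * \<rho> ^ n) / n"
      by (intro always_eventually allI divide_right_mono) auto
  qed
qed

end

section \<open>Potentials\<close>

definition dirichlet ::
  "('a, 'b) pre_digraph \<Rightarrow> ('b \<Rightarrow> real) \<Rightarrow> ('a \<Rightarrow> real) \<Rightarrow> ('a \<Rightarrow> real) \<Rightarrow> real" where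
  "dirichlet G r f \<phi> =
     (\<Sum>e\<in>arcs G. (f (tail G e) - f (head G e)) * (\<phi> (tail G e) - \<phi> (head G e)) / r e)"

text \<open>The weighted graph Laplacian of \<open>\<phi>\<close>, with the sign that makes it
  positive semidefinite for positive resistances.\<close>

definition net_current :: "('a, 'b) pre_digraph \<Rightarrow> ('b \<Rightarrow> real) \<Rightarrow> ('a \<Rightarrow> real) \<Rightarrow> 'a \<Rightarrow> real" where
  "net_current G r \<phi> x =
     (\<Sum>e | e \<in> arcs G \<and> tail G e = x. (\<phi> x - \<phi> (head G e)) / r e) +
     (\<Sum>e | e \<in> arcs G \<and> head G e = x. (\<phi> x - \<phi> (tail G e)) / r e)"

text \<open>The weak form of \<^const>\<open>unit_potential\<close>: Kirchhoff's law tested against \<open>f\<close>. It refers to arcs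
  only, which makes it compatible with substitution without a case distinction on the vertices.\<close>

definition weak_potential ::
  "('a, 'b) pre_digraph \<Rightarrow> ('b \<Rightarrow> real) \<Rightarrow> 'a \<Rightarrow> 'a \<Rightarrow> ('a \<Rightarrow> real) \<Rightarrow> bool" where
  "weak_potential G r u w \<phi> \<longleftrightarrow> (\<forall>f. dirichlet G r f \<phi> = f u - f w)"

lemma dirichlet_commute: "dirichlet G r f \<phi> = dirichlet G r \<phi> f"
  unfolding dirichlet_def by (simp add: mult.commute)

lemma dirichlet_scale_left: "dirichlet G r (\<lambda>x. t * f x) \<phi> = t * dirichlet G r f \<phi>"
  unfolding dirichlet_def by (simp add: sum_distrib_left algebra_simps diff_divide_distrib add_divide_distrib)

lemma dirichlet_nonneg: "(\<And>e. e \<in> arcs G \<Longrightarrow> 0 < r e) \<Longrightarrow> 0 \<le> dirichlet G r f f"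
  unfolding dirichlet_def by (intro sum_nonneg) (simp add: less_imp_le)

lemma dirichlet_square_diff:
  "dirichlet G r (\<lambda>x. f x - g x) (\<lambda>x. f x - g x) =
     dirichlet G r f f - 2 * dirichlet G r f g + dirichlet G r g g"
  unfolding dirichlet_def sum_distrib_left sum_subtractf[symmetric] sum.distrib[symmetric]
  by (intro sum.cong) (simp_all add: algebra_simps diff_divide_distrib add_divide_distrib)

context fin_digraph
begin

text \<open>Summation by parts: the current through an arc counts positively at its tail and
  negatively at its head.\<close>

lemma green_identity: "(\<Sum>x\<in>verts G. f x * net_current G r \<phi> x) = dirichlet G r f \<phi>"
proof -
  let ?g = "\<lambda>e. (\<phi> (tail G e) - \<phi> (head G e)) / r e"
  have t: "(\<Sum>x\<in>verts G. \<Sum>e | e \<in> arcs G \<and> tail G e = x. f (tail G e) * ?g e) = (\<Sum>e\<in>arcs G. f (tail G e) * ?g e)"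
    by (rule sum.group) auto
  have h: "(\<Sum>x\<in>verts G. \<Sum>e | e \<in> arcs G \<and> head G e = x. f (head G e) * - ?g e) = (\<Sum>e\<in>arcs G. f (head G e) * - ?g e)"
    by (rule sum.group) auto
  have "f x * net_current G r \<phi> x =
      (\<Sum>e | e \<in> arcs G \<and> tail G e = x. f (tail G e) * ?g e) +
      (\<Sum>e | e \<in> arcs G \<and> head G e = x. f (head G e) * - ?g e)" for x
    unfolding net_current_def distrib_left sum_distrib_left
    by (intro arg_cong2[of _ _ _ _ "(+)"] sum.cong) (auto simp: divide_simps algebra_simps)
  then have "(\<Sum>x\<in>verts G. f x * net_current G r \<phi> x) =
      (\<Sum>e\<in>arcs G. f (tail G e) * ?g e) + (\<Sum>e\<in>arcs G. f (head G e) * - ?g e)"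
    by (simp only: sum.distrib t h)
  also have "\<dots> = dirichlet G r f \<phi>"
    unfolding dirichlet_def by (simp add: sum.distrib[symmetric] algebra_simps diff_divide_distrib add_divide_distrib)
  finally show ?thesis .
qed

text \<open>Testing with the indicator of a vertex recovers Kirchhoff's law there; conversely the
  pointwise law is summed against \<open>f\<close>.\<close>

lemma unit_potential_iff_weak:
  assumes "u \<in> verts G" "w \<in> verts G"
  shows "unit_potential G r u w \<phi> \<longleftrightarrow> weak_potential G r u w \<phi>"
proof -
  have U: "unit_potential G r u w \<phi> \<longleftrightarrow>
      (\<forall>x\<in>verts G. net_current G r \<phi> x = of_bool (x = u) - of_bool (x = w))"
    by (simp add: unit_potential_def net_current_def)
  have pick: "(\<Sum>x\<in>verts G. f x * of_bool (x = v)) = f v" if "v \<in> verts G" for f :: "'a \<Rightarrow> real" and v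
    using that by (simp add: of_bool_def if_distrib[of "(*) _"] cong: if_cong)
  show ?thesis
  proof
    assume up: "unit_potential G r u w \<phi>"
    have "dirichlet G r f \<phi> = (\<Sum>x\<in>verts G. f x * (of_bool (x = u) - of_bool (x = w)))" for f
      unfolding green_identity[symmetric] using up U by (intro sum.cong) auto
    then show "weak_potential G r u w \<phi>"
      by (simp add: weak_potential_def right_diff_distrib sum_subtractf pick assms)
  next
    assume wp: "weak_potential G r u w \<phi>"
    have "net_current G r \<phi> x = of_bool (x = u) - of_bool (x = w)" if x: "x \<in> verts G" for x
    proof -
      have "net_current G r \<phi> x = dirichlet G r (\<lambda>y. of_bool (y = x)) \<phi>"
        unfolding green_identity[symmetric] using pick[OF x, of "net_current G r \<phi>"] by (simp add: mult.commute)
      then show ?thesis using wp by (auto simp: weak_potential_def)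
    qed
    then show "unit_potential G r u w \<phi>" using U by blast
  qed
qed

end

text \<open>Test each potential against the other and use symmetry of the form. The
  \<open>THE\<close> in \<open>eff_res\<close> is thereby well defined without uniqueness of the
  potential itself.\<close>

lemma weak_potential_unique_drop:
  assumes "weak_potential G r u w \<phi>" "weak_potential G r u w \<psi>"
  shows "\<phi> u - \<phi> w = \<psi> u - \<psi> w"
  using assms dirichlet_commute by (metis weak_potential_def)

lemma (in fin_digraph) eff_res_eqI:
  assumes "u \<in> verts G" "w \<in> verts G" "weak_potential G r u w \<phi>"
  shows "eff_res G r u w = \<phi> u - \<phi> w"
  unfolding eff_res_def unit_potential_iff_weak[OF assms(1,2)]
  using weak_potential_unique_drop[OF _ assms(3)] assms(3) by (intro the_equality) blast+

section \<open>Solvability of Kirchhoff's equations\<close>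

lemma square_system_solvable:
  fixes A :: "'a \<Rightarrow> 'a \<Rightarrow> real"
  assumes "finite V"
    and inj: "\<And>f. (\<And>x. x \<in> V \<Longrightarrow> (\<Sum>y\<in>V. A x y * f y) = 0) \<Longrightarrow> (\<forall>x\<in>V. f x = 0)"
  shows "\<exists>f. \<forall>x\<in>V. (\<Sum>y\<in>V. A x y * f y) = b x"
proof -
  let ?n = "card V"
  obtain h where h: "bij_betw h {0..<?n} V" using ex_bij_betw_nat_finite[OF assms(1)] by blast
  let ?inv = "inv_into {0..<?n} h"
  have hinv: "?inv x < ?n" "h (?inv x) = x" if "x \<in> V" for x
    using that h bij_betw_inv_into[OF h] by (auto simp: bij_betw_def f_inv_into_f dest: inv_into_into)
  have hV: "h i \<in> V" "?inv (h i) = i" if "i < ?n" for i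
    using that h by (auto simp: bij_betw_def)
  define M where "M = mat ?n ?n (\<lambda>(i, j). A (h i) (h j))"
  have M: "M \<in> carrier_mat ?n ?n" by (simp add: M_def)
  have Mv: "(M *\<^sub>v v) $ i = (\<Sum>y\<in>V. A (h i) y * v $ ?inv y)" if "v \<in> carrier_vec ?n" "i < ?n" for v i
  proof -
    have "(M *\<^sub>v v) $ i = (\<Sum>j = 0..<?n. A (h i) (h j) * v $ ?inv (h j))"
      using that hV by (simp add: M_def scalar_prod_def)
    also have "\<dots> = (\<Sum>y\<in>V. A (h i) y * v $ ?inv y)"
      using h by (rule sum.reindex_bij_betw)
    finally show ?thesis .
  qed
  \<comment> \<open>A kernel vector of \<open>M\<close>, read along the enumeration
    \<open>h\<close>, is a kernel function of \<open>A\<close>; hence \<open>M\<close> is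
    invertible.\<close>
  have "det M \<noteq> 0"
  proof
    assume "det M = 0"
    then obtain v where v: "v \<in> carrier_vec ?n" "v \<noteq> 0\<^sub>v ?n" "M *\<^sub>v v = 0\<^sub>v ?n"
      using det_0_iff_vec_prod_zero[OF M] by blast
    have "(\<Sum>y\<in>V. A x y * v $ ?inv y) = 0" if "x \<in> V" for x
      using Mv[OF v(1) hinv(1)[OF that]] v(3) hinv[OF that] by simp
    then have z: "\<forall>x\<in>V. v $ ?inv x = 0" by (rule inj)
    have "v $ i = 0" if "i < ?n" for i
      using z hV[OF that] by fastforce
    then have "v = 0\<^sub>v ?n" using v(1) by auto
    then show False using v(2) by simp
  qed
  then obtain B where B: "B \<in> carrier_mat ?n ?n" "M * B = 1\<^sub>m ?n"
    using det_non_zero_imp_unit[OF M] M unfolding Units_def by (auto simp: ring_mat_def)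
  define v where "v = B *\<^sub>v vec ?n (\<lambda>i. b (h i))"
  have v: "v \<in> carrier_vec ?n" using B by (simp add: v_def)
  have "M *\<^sub>v v = vec ?n (\<lambda>i. b (h i))"
    unfolding v_def using B M by (simp flip: assoc_mult_mat_vec)
  then have "(\<Sum>y\<in>V. A x y * v $ ?inv y) = b x" if "x \<in> V" for x
    using Mv[OF v hinv(1)[OF that]] hinv[OF that] by simp
  then show ?thesis by (intro exI[of _ "\<lambda>y. v $ ?inv y"]) blast
qed

text \<open>The Laplacian annihilates constants, so its row at \<open>w\<close> is replaced by the
  normalisation that the potential vanishes at \<open>w\<close>; the resulting matrix
  \<open>A\<close> is injective.\<close>

lemma (in fin_digraph) ex_weak_potential:
  assumes conn: "Digraph_Component.connected G" and r: "\<And>e. e \<in> arcs G \<Longrightarrow> 0 < r e"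
    and uw: "u \<in> verts G" "w \<in> verts G"
  shows "\<exists>\<phi>. weak_potential G r u w \<phi>"
proof -
  define L where "L x y = net_current G r (\<lambda>z. of_bool (z = y)) x" for x y
  define A where "A x y = (if x = w then of_bool (y = w) else L x y)" for x y
  have L: "net_current G r f x = (\<Sum>y\<in>verts G. L x y * f y)" if "x \<in> verts G" for f x
  proof -
    have rep: "(f z - f z') / q = (\<Sum>y\<in>verts G. (of_bool (z = y) - of_bool (z' = y)) / q * f y)"
      if "z \<in> verts G" "z' \<in> verts G" for z z' q
    proof -
      have pick: "(\<Sum>y\<in>verts G. of_bool (v = y) * f y) = f v" if "v \<in> verts G" for v
      proof -
        have "(\<Sum>y\<in>verts G. of_bool (v = y) * f y) = (\<Sum>y\<in>verts G. if v = y then f y else 0)"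
          by (intro sum.cong) auto
        then show ?thesis using that by simp
      qed
      have "(f z - f z') / q = ((\<Sum>y\<in>verts G. of_bool (z = y) * f y) - (\<Sum>y\<in>verts G. of_bool (z' = y) * f y)) / q"
        using pick[OF that(1)] pick[OF that(2)] by simp
      also have "\<dots> = (\<Sum>y\<in>verts G. (of_bool (z = y) - of_bool (z' = y)) / q * f y)"
        unfolding sum_subtractf[symmetric] sum_divide_distrib by (intro sum.cong) (auto simp: algebra_simps)
      finally show ?thesis .
    qed
    have "net_current G r f x =
       (\<Sum>e | e \<in> arcs G \<and> tail G e = x. \<Sum>y\<in>verts G. (of_bool (x = y) - of_bool (head G e = y)) / r e * f y) +
       (\<Sum>e | e \<in> arcs G \<and> head G e = x. \<Sum>y\<in>verts G. (of_bool (x = y) - of_bool (tail G e = y)) / r e * f y)"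
      unfolding net_current_def
      by (intro arg_cong2[of _ _ _ _ "(+)"] sum.cong refl rep) (auto simp: that)
    also have "\<dots> = (\<Sum>y\<in>verts G. L x y * f y)"
      unfolding L_def net_current_def distrib_right sum_distrib_right sum.distrib
      by (intro arg_cong2[of _ _ _ _ "(+)"] sum.swap)
    finally show ?thesis .
  qed
  have Aw: "(\<Sum>y\<in>verts G. A w y * f y) = f w" for f
    using uw by (simp add: A_def of_bool_def if_distrib[of "\<lambda>a. a * _"] cong: if_cong)
  have Ax: "(\<Sum>y\<in>verts G. A x y * f y) = net_current G r f x" if "x \<in> verts G" "x \<noteq> w" for x f
    using L[OF that(1)] that(2) by (simp add: A_def)
  have total: "(\<Sum>x\<in>verts G. net_current G r f x) = 0" for f
    using green_identity[of "\<lambda>_. 1" r f] by (simp add: dirichlet_def)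
  \<comment> \<open>Net currents sum to zero, so Kirchhoff's law at \<open>w\<close>, whose equation
    was given up, follows from all the others.\<close>
  have at_w: "net_current G r f w = b w" if "\<And>x. x \<in> verts G \<Longrightarrow> x \<noteq> w \<Longrightarrow> net_current G r f x = b x"
    "(\<Sum>x\<in>verts G. b x) = 0" for f b
  proof -
    have "(\<Sum>x\<in>verts G - {w}. net_current G r f x) = (\<Sum>x\<in>verts G - {w}. b x)"
      using that(1) by (intro sum.cong) auto
    then show ?thesis
      using total[of f] that(2) sum.remove[OF finite_verts uw(2), of "net_current G r f"]
        sum.remove[OF finite_verts uw(2), of b] by linarith
  qed
  have "\<forall>x\<in>verts G. f x = 0" if f: "\<And>x. x \<in> verts G \<Longrightarrow> (\<Sum>y\<in>verts G. A x y * f y) = 0" for f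
  proof -
    have fw: "f w = 0" using f[OF uw(2)] Aw by simp
    have nz: "net_current G r f x = 0" if "x \<in> verts G" "x \<noteq> w" for x
      using f[OF that(1)] Ax[OF that, of f] by simp
    then have "net_current G r f x = 0" if "x \<in> verts G" for x
      using at_w[of f "\<lambda>_. 0"] that by (cases "x = w") simp_all
    \<comment> \<open>Zero energy forces equal potentials across every arc; connectedness then
      spreads the value 0 from \<open>w\<close>.\<close>
    then have "dirichlet G r f f = 0" using green_identity[of f r f] by simp
    then have *: "f (tail G e) = f (head G e)" if "e \<in> arcs G" for e
      unfolding dirichlet_def using that r
      by (subst (asm) sum_nonneg_eq_0_iff) (force simp: less_imp_le)+
    show ?thesis
    proof
      fix x assume x: "x \<in> verts G"
      have "w \<rightarrow>\<^sup>*\<^bsub>with_proj (mk_symmetric G)\<^esub> x"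
        using conn x uw by (auto simp: connected_def strongly_connected_def)
      then have "(w, x) \<in> (parcs (mk_symmetric G))\<^sup>*"
        by (auto simp: reachable_def intro: rtrancl_on_rtranclI)
      then have "f x = f w"
        by (induction rule: rtrancl_induct) (auto simp: parcs_mk_symmetric *)
      then show "f x = 0" using fw by simp
    qed
  qed
  then obtain \<phi> where \<phi>: "\<forall>x\<in>verts G. (\<Sum>y\<in>verts G. A x y * \<phi> y) = (if x = w then 0 else of_bool (x = u) - of_bool (x = w))"
    using square_system_solvable[OF finite_verts, of A "\<lambda>x. (if x = w then 0 else of_bool (x = u) - of_bool (x = w))"] by blast
  have "(\<Sum>x\<in>verts G. of_bool (x = u) - of_bool (x = w) :: real) = 0"
    using uw by (simp add: sum_subtractf)
  moreover have "net_current G r \<phi> x = of_bool (x = u) - of_bool (x = w)" if "x \<in> verts G" "x \<noteq> w" for x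
    using \<phi> that Ax[OF that, of \<phi>] by simp
  ultimately have "net_current G r \<phi> x = of_bool (x = u) - of_bool (x = w)" if "x \<in> verts G" for x
    using at_w[of \<phi> "\<lambda>x. of_bool (x = u) - of_bool (x = w)"] that by (cases "x = w") blast+
  then have "unit_potential G r u w \<phi>" by (simp add: unit_potential_def net_current_def)
  then show ?thesis using unit_potential_iff_weak[OF uw] by blast
qed

section \<open>Variational bounds on the resistance\<close>

lemma weak_potential_scale:
  assumes "weak_potential G r u w \<phi>" "t \<noteq> 0"
  shows "weak_potential G (\<lambda>e. t * r e) u w (\<lambda>x. t * \<phi> x)"
  using assms unfolding weak_potential_def dirichlet_def
  by (simp add: right_diff_distrib[symmetric] mult.left_commute[of _ t])

text \<open>Expand the nonnegative energy of \<open>f - \<phi>\<close>. Equality holds at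
  \<open>f = \<phi>\<close>, so the resistance is a maximum over test functions, and lower bounds
  come from choosing \<open>f\<close>.\<close>

lemma weak_potential_drop_ge:
  assumes r: "\<And>e. e \<in> arcs G \<Longrightarrow> 0 < r e" and \<phi>: "weak_potential G r u w \<phi>"
  shows "2 * (f u - f w) - dirichlet G r f f \<le> \<phi> u - \<phi> w"
  using dirichlet_nonneg[of G r "\<lambda>x. f x - \<phi> x"] r \<phi>
  by (simp add: dirichlet_square_diff weak_potential_def)

text \<open>Rayleigh monotonicity: \<open>\<phi>\<close> serves as test function for
  \<open>r'\<close>, where its energy is no larger than its energy for \<open>r\<close>, which is
  its drop.\<close>

lemma weak_potential_drop_mono:
  assumes r: "\<And>e. e \<in> arcs G \<Longrightarrow> 0 < r e" "\<And>e. e \<in> arcs G \<Longrightarrow> r e \<le> r' e"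
    and \<phi>: "weak_potential G r u w \<phi>" and \<psi>: "weak_potential G r' u w \<psi>"
  shows "\<phi> u - \<phi> w \<le> \<psi> u - \<psi> w"
proof -
  have "dirichlet G r' \<phi> \<phi> \<le> dirichlet G r \<phi> \<phi>"
    unfolding dirichlet_def using r by (intro sum_mono divide_left_mono mult_pos_pos) (auto intro: less_le_trans)
  moreover have "2 * (\<phi> u - \<phi> w) - dirichlet G r' \<phi> \<phi> \<le> \<psi> u - \<psi> w"
    using r by (intro weak_potential_drop_ge[OF _ \<psi>]) (auto intro: less_le_trans)
  ultimately show ?thesis using \<phi> by (simp add: weak_potential_def)
qed

text \<open>The energy of \<open>\<phi>\<close> falls strictly once the resistance grows on an arc
  that carries current.\<close>

lemma (in fin_digraph) weak_potential_drop_strict_mono: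
  assumes r: "\<And>e. e \<in> arcs G \<Longrightarrow> 0 < r e" "\<And>e. e \<in> arcs G \<Longrightarrow> r e \<le> r' e"
    and e: "e \<in> arcs G" "r e < r' e" "\<phi> (tail G e) \<noteq> \<phi> (head G e)"
    and \<phi>: "weak_potential G r u w \<phi>" and \<psi>: "weak_potential G r' u w \<psi>"
  shows "\<phi> u - \<phi> w < \<psi> u - \<psi> w"
proof -
  have "dirichlet G r' \<phi> \<phi> < dirichlet G r \<phi> \<phi>"
    unfolding dirichlet_def
  proof (rule sum_strict_mono_ex1)
    show "\<forall>x\<in>arcs G. (\<phi> (tail G x) - \<phi> (head G x)) * (\<phi> (tail G x) - \<phi> (head G x)) / r' x
        \<le> (\<phi> (tail G x) - \<phi> (head G x)) * (\<phi> (tail G x) - \<phi> (head G x)) / r x"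
      using r by (intro ballI divide_left_mono mult_pos_pos) (auto intro: less_le_trans)
    let ?d = "\<phi> (tail G e) - \<phi> (head G e)"
    have "?d * ?d / r' e < ?d * ?d / r e"
    proof (rule divide_strict_left_mono[OF e(2)])
      show "0 < ?d * ?d" using e(3) by (metis not_real_square_gt_zero right_minus_eq)
      show "0 < r' e * r e" using r(1)[OF e(1)] e(2) by simp
    qed
    then show "\<exists>a\<in>arcs G. (\<phi> (tail G a) - \<phi> (head G a)) * (\<phi> (tail G a) - \<phi> (head G a)) / r' a
        < (\<phi> (tail G a) - \<phi> (head G a)) * (\<phi> (tail G a) - \<phi> (head G a)) / r a"
      using e(1) by blast
  qed simp
  moreover have "2 * (\<phi> u - \<phi> w) - dirichlet G r' \<phi> \<phi> \<le> \<psi> u - \<psi> w"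
    using r by (intro weak_potential_drop_ge[OF _ \<psi>]) (auto intro: less_le_trans)
  ultimately show ?thesis using \<phi> by (simp add: weak_potential_def)
qed

text \<open>\<open>f\<close> is the indicator function of one side of a cut whose arcs belong to \<open>C\<close>.\<close>

definition separates :: "('a, 'b) pre_digraph \<Rightarrow> 'b set \<Rightarrow> 'a \<Rightarrow> 'a \<Rightarrow> bool" where
  "separates G C u w \<longleftrightarrow> (\<exists>f :: 'a \<Rightarrow> real. f u = 1 \<and> f w = 0 \<and> (\<forall>x. f x = 0 \<or> f x = 1) \<and>
     (\<forall>e \<in> arcs G - C. f (tail G e) = f (head G e)))"

text \<open>Testing against the indicator of one side shows that the unit current has to cross the
  cut.\<close>

lemma separates_drop_nonzero:
  assumes "separates G C u w" "weak_potential G r u w \<phi>"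
  shows "\<exists>e \<in> arcs G \<inter> C. \<phi> (tail G e) \<noteq> \<phi> (head G e)"
proof (rule ccontr)
  assume *: "\<not> ?thesis"
  obtain f :: "'a \<Rightarrow> real" where f: "f u = 1" "f w = 0" "\<forall>e \<in> arcs G - C. f (tail G e) = f (head G e)"
    using assms(1) by (auto simp: separates_def)
  have "dirichlet G r f \<phi> = 0" unfolding dirichlet_def
    using f(3) * by (intro sum.neutral) auto
  then show False using assms(2) f by (simp add: weak_potential_def)
qed

lemma (in fin_digraph) separates_drop_ge:
  assumes sep: "separates G C u w" and r: "\<And>e. e \<in> arcs G \<Longrightarrow> 0 < r e"
    and \<phi>: "weak_potential G r u w \<phi>" and q: "0 < q" "\<And>e. e \<in> arcs G \<inter> C \<Longrightarrow> q \<le> r e"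
  shows "q / card (arcs G) \<le> \<phi> u - \<phi> w"
proof -
  obtain f :: "'a \<Rightarrow> real" where f: "f u = 1" "f w = 0" "\<And>x. f x = 0 \<or> f x = 1"
    "\<And>e. e \<in> arcs G - C \<Longrightarrow> f (tail G e) = f (head G e)"
    using sep by (auto simp: separates_def)
  let ?N = "real (card (arcs G))"
  have "arcs G \<noteq> {}" using separates_drop_nonzero[OF sep \<phi>] by blast
  then have N: "0 < ?N" by (simp add: card_gt_0_iff)
  have "dirichlet G r f f \<le> (\<Sum>e\<in>arcs G. 1 / q)"
    unfolding dirichlet_def
  proof (rule sum_mono)
    fix e assume e: "e \<in> arcs G"
    let ?d = "f (tail G e) - f (head G e)"
    show "?d * ?d / r e \<le> 1 / q"
    proof (cases "?d = 0")
      case True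
      then show ?thesis using q(1) by simp
    next
      case False
      then have "e \<in> C" using f(4) e by auto
      moreover have "?d * ?d = 1" using False f(3)[of "tail G e"] f(3)[of "head G e"] by auto
      ultimately show ?thesis using q e by (simp add: frac_le)
    qed
  qed
  then have D: "dirichlet G r f f \<le> ?N / q" by simp
  \<comment> \<open>With energy at most \<open>?N / q\<close>, the multiple \<open>t * f\<close>
    yields the bound \<open>2 * t - t * t * ?N / q\<close>, which is largest at this
    \<open>t\<close>, with value \<open>q / ?N\<close>.\<close>
  let ?t = "q / ?N"
  have "2 * (?t * f u - ?t * f w) - dirichlet G r (\<lambda>x. ?t * f x) (\<lambda>x. ?t * f x) \<le> \<phi> u - \<phi> w"
    by (rule weak_potential_drop_ge[OF r \<phi>])
  moreover have "dirichlet G r (\<lambda>x. ?t * f x) (\<lambda>x. ?t * f x) = ?t * (?t * dirichlet G r f f)"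
    by (metis (no_types) dirichlet_commute dirichlet_scale_left)
  moreover have "?t * (?t * dirichlet G r f f) \<le> ?t * (?t * (?N / q))"
    using D q(1) by (intro mult_left_mono) auto
  moreover have "?t * (?t * (?N / q)) = ?t" using N q(1) by simp
  ultimately show ?thesis using f by simp
qed

section \<open>Walks recorded by their arcs and total cost\<close>

definition orient :: "('a, 'b) pre_digraph \<Rightarrow> 'b \<Rightarrow> 'a \<Rightarrow> 'a \<Rightarrow> bool" where
  "orient G e x y \<longleftrightarrow> e \<in> arcs G \<and> (x = tail G e \<and> y = head G e \<or> x = head G e \<and> y = tail G e)"

text \<open>The set \<open>E\<close> forgets repeated arcs while the cost counts them, so the sum of
  \<open>r\<close> over \<open>E\<close> is only a lower bound for the cost when \<open>r\<close> is
  nonnegative. The empty walk is allowed at any point, vertex or not.\<close>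

inductive walk_cost :: "('a, 'b) pre_digraph \<Rightarrow> ('b \<Rightarrow> real) \<Rightarrow> 'a \<Rightarrow> 'a \<Rightarrow> 'b set \<Rightarrow> real \<Rightarrow> bool"
  for G r where
  stay: "walk_cost G r x x {} 0"
| move: "orient G e x y \<Longrightarrow> walk_cost G r y z E t \<Longrightarrow> walk_cost G r x z (insert e E) (r e + t)"

lemma orient_sym: "orient G e x y \<Longrightarrow> orient G e y x"
  by (auto simp: orient_def)

lemma walk_cost_trans:
  "walk_cost G r x y E s \<Longrightarrow> walk_cost G r y z E' t \<Longrightarrow> walk_cost G r x z (E \<union> E') (s + t)"
  by (induction rule: walk_cost.induct) (auto intro: walk_cost.move simp: add.assoc)

lemma walk_cost_sym: "walk_cost G r x y E t \<Longrightarrow> walk_cost G r y x E t"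
proof (induction rule: walk_cost.induct)
  case (move e x y z E t)
  have "walk_cost G r y x (insert e {}) (r e + 0)"
    by (rule walk_cost.move[OF orient_sym[OF move.hyps(1)] walk_cost.stay])
  from walk_cost_trans[OF move.IH this] show ?case by (simp add: add.commute)
qed (rule walk_cost.stay)

text \<open>One side of the cut is the set of points reachable from \<open>u\<close> by walks
  avoiding \<open>C\<close>; an arc outside \<open>C\<close> cannot leave or enter it.\<close>

lemma separates_if_walks_meet:
  fixes G :: "('a, 'b) pre_digraph"
  assumes "\<And>E t. walk_cost G r u w E t \<Longrightarrow> E \<inter> C \<noteq> {}"
  shows "separates G C u w"
proof -
  define R where "R x \<longleftrightarrow> (\<exists>E t. walk_cost G r u x E t \<and> E \<inter> C = {})" for x
  define f :: "'a \<Rightarrow> real" where "f x = of_bool (R x)" for x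
  have "f u = 1" using walk_cost.stay[of G r u] by (auto simp: f_def R_def)
  moreover have "f w = 0" using assms by (auto simp: f_def R_def)
  moreover have "f y = 1" if e: "orient G e x y" "e \<notin> C" "f x = 1" for e x y
  proof -
    obtain E t where E: "walk_cost G r u x E t" "E \<inter> C = {}" using e(3) by (auto simp: f_def R_def)
    have "walk_cost G r u y (E \<union> insert e {}) (t + (r e + 0))"
      by (rule walk_cost_trans[OF E(1) walk_cost.move[OF e(1) walk_cost.stay]])
    moreover have "(E \<union> insert e {}) \<inter> C = {}" using E(2) e(2) by auto
    ultimately show ?thesis unfolding f_def R_def by auto
  qed
  then have "f (tail G e) = f (head G e)" if "e \<in> arcs G - C" for e
    using that by (smt (verit) DiffD1 DiffD2 f_def of_bool_eq(1) of_bool_eq(2) of_bool_def orient_def)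
  moreover have "f x = 0 \<or> f x = 1" for x by (simp add: f_def)
  ultimately show ?thesis unfolding separates_def by blast
qed

section \<open>Walks and distances\<close>

lemma walk_cost_finite: "walk_cost G r x y E t \<Longrightarrow> finite E"
  by (induction rule: walk_cost.induct) auto

lemma walk_cost_arcs: "walk_cost G r x y E t \<Longrightarrow> E \<subseteq> arcs G"
  by (induction rule: walk_cost.induct) (auto simp: orient_def)

lemma walk_cost_ge_sum:
  assumes "\<And>e. e \<in> arcs G \<Longrightarrow> 0 \<le> r e"
  shows "walk_cost G r x y E t \<Longrightarrow> sum r E \<le> t"
proof (induction rule: walk_cost.induct)
  case (move e x y z E t)
  have "0 \<le> r e" using move.hyps(1) assms by (simp add: orient_def)
  then show ?case
    using move.IH walk_cost_finite[OF move.hyps(2)] by (cases "e \<in> E") (simp_all add: insert_absorb)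
qed simp

definition lip :: "('a, 'b) pre_digraph \<Rightarrow> ('b \<Rightarrow> real) \<Rightarrow> ('a \<Rightarrow> real) \<Rightarrow> bool" where
  "lip G r f \<longleftrightarrow> (\<forall>e\<in>arcs G. \<bar>f (tail G e) - f (head G e)\<bar> \<le> r e)"

text \<open>Weak duality for shortest paths: the differences telescope along the walk, each bounded
  by the length of its arc.\<close>

lemma lip_walk_cost:
  assumes "lip G r f"
  shows "walk_cost G r x y E t \<Longrightarrow> f x - f y \<le> t"
proof (induction rule: walk_cost.induct)
  case (move e x y z E t)
  then have "f x - f y \<le> r e" using assms by (fastforce simp: lip_def orient_def)
  then show ?case using move.IH by simp
qed simp

context wf_digraph
begin

interpretation U: pair_wf_digraph "mk_symmetric G" ..

lemma arc_und_iff: "ab \<in> parcs (mk_symmetric G) \<longleftrightarrow> (\<exists>e. orient G e (fst ab) (snd ab))"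
  by (cases ab) (auto simp: parcs_mk_symmetric orient_def)

text \<open>The conditional last conjunct lets one induction serve both purposes: control of the
  arcs for arbitrary lengths, and the number of steps for unit lengths.\<close>

lemma walk_cost_imp_awalk:
  "walk_cost G r x y E t \<Longrightarrow> y \<in> verts G \<Longrightarrow>
    \<exists>p. U.awalk x p y \<and> (\<forall>ab\<in>set p. \<exists>e\<in>E. orient G e (fst ab) (snd ab)) \<and>
      ((\<forall>e. r e = 1) \<longrightarrow> t = real (length p))"
proof (induction rule: walk_cost.induct)
  case (stay x)
  then show ?case by (intro exI[of _ "[]"]) (simp add: U.awalk_Nil_iff)
next
  case (move e x y z E t)
  then obtain p where p: "U.awalk y p z" "\<forall>ab\<in>set p. \<exists>e\<in>E. orient G e (fst ab) (snd ab)"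
    "(\<forall>e. r e = 1) \<longrightarrow> t = real (length p)" by blast
  have "(x, y) \<in> parcs (mk_symmetric G)" using move.hyps(1) by (auto simp: arc_und_iff)
  then have "U.awalk x ((x, y) # p) z" using p(1) by (simp add: U.awalk_Cons_iff)
  then show ?case using p(2,3) move.hyps(1) by (intro exI[of _ "(x, y) # p"]) auto
qed

lemma awalk_imp_walk_cost:
  "U.awalk x p y \<Longrightarrow> \<exists>E. walk_cost G (\<lambda>_. 1) x y E (length p)"
proof (induction p arbitrary: x)
  case Nil
  then show ?case using walk_cost.stay by (fastforce simp: U.awalk_Nil_iff)
next
  case (Cons ab p)
  obtain a b where ab: "ab = (a, b)" by (cases ab)
  from Cons.prems ab obtain e where e: "orient G e x b" "U.awalk b p y"
    by (auto simp: U.awalk_Cons_iff arc_und_iff)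
  with Cons.IH obtain E where "walk_cost G (\<lambda>_. 1) b y E (length p)" by blast
  from walk_cost.move[OF e(1) this] show ?case by auto
qed

text \<open>A walk of length \<open>d\<close> bounds the distance above, a Lipschitz function
  dropping by at least \<open>d\<close> bounds it below.\<close>

lemma graph_dist_eqI:
  assumes y: "y \<in> verts G" and walk: "walk_cost G (\<lambda>_. 1) x y E d"
    and f: "lip G (\<lambda>_. 1) f" "d \<le> f x - f y"
  shows "real (graph_dist G x y) = d"
proof -
  obtain p where p: "U.awalk x p y" "d = length p" using walk_cost_imp_awalk[OF walk y] by auto
  have "length p \<le> k" if "U.awalk x q y" "length q = k" for q k
    using awalk_imp_walk_cost[OF that(1)] lip_walk_cost[OF f(1)] f(2) that(2) p(2) by fastforce
  then have "graph_dist G x y = length p"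
    unfolding graph_dist_def using p(1) by (intro Least_equality) auto
  then show ?thesis using p(2) by simp
qed

lemma graph_dist_le:
  assumes "y \<in> verts G" "walk_cost G (\<lambda>_. 1) x y E t"
  shows "real (graph_dist G x y) \<le> t"
proof -
  obtain p where p: "U.awalk x p y" "t = length p" using walk_cost_imp_awalk[OF assms(2,1)] by auto
  then have "graph_dist G x y \<le> length p" unfolding graph_dist_def by (intro Least_le) blast
  then show ?thesis using p(2) by simp
qed

end

text \<open>Simple paths rather than walks make this a minimum of a finite set, and match the rows
  of the distance matrices.\<close>

definition min_path :: "('a, 'b) pre_digraph \<Rightarrow> ('b \<Rightarrow> real) \<Rightarrow> 'a \<Rightarrow> 'a \<Rightarrow> real" where
  "min_path G r u w = Min ((\<lambda>p. sum r (path_arcs G p)) ` {p. simple_path G u p w})"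

locale sc_graph = digraph G for G :: "('a, 'b) pre_digraph" +
  assumes asym: "asym (arcs_ends G)" and conn: "Digraph_Component.connected G"
begin

interpretation U: pair_fin_digraph "mk_symmetric G" ..

text \<open>Parallel arcs are excluded by \<open>digraph\<close>, antiparallel ones by
  \<open>asym\<close>. Hence the vertex pairs of a path determine its arcs.\<close>

lemma orient_unique:
  assumes "orient G e x y" "orient G e' x y"
  shows "e = e'"
proof -
  have ends: "(tail G a, head G a) \<in> arcs_ends G" if "a \<in> arcs G" for a
    using that by (auto simp: arcs_ends_def arc_to_ends_def)
  have "e \<in> arcs G" "e' \<in> arcs G" using assms by (auto simp: orient_def)
  moreover have "arc_to_ends G e = arc_to_ends G e'"
    using assms asymD[OF asym] ends unfolding orient_def arc_to_ends_def by metis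
  ultimately show ?thesis by (rule no_multi_arcs)
qed

lemma path_arcs_orient:
  "path_arcs G p = {e. \<exists>ab\<in>set p. orient G e (fst ab) (snd ab)}"
  unfolding path_arcs_def orient_def by force

lemma finite_path_arcs: "finite (path_arcs G p)"
  by (rule finite_subset[OF _ finite_arcs]) (auto simp: path_arcs_def)

lemma finite_simple_paths: "finite {p. simple_path G u p w}"
  unfolding simple_path_def by (rule U.apaths_finite)

lemma ex_simple_path:
  assumes "u \<in> verts G" "w \<in> verts G"
  shows "\<exists>p. simple_path G u p w"
  using conn assms U.reachable_apath[of u w]
  by (auto simp: simple_path_def connected_def strongly_connected_def)

text \<open>Loop erasure uses no new vertex pairs, hence by uniqueness of arcs no new arcs.\<close>

lemma simple_path_subset_walk:
  assumes "walk_cost G r u w E t" "w \<in> verts G"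
  shows "\<exists>p. simple_path G u p w \<and> path_arcs G p \<subseteq> E"
proof -
  obtain p where p: "U.awalk u p w" "\<forall>ab\<in>set p. \<exists>e\<in>E. orient G e (fst ab) (snd ab)"
    using walk_cost_imp_awalk[OF assms] by blast
  have "simple_path G u (U.awalk_to_apath p) w"
    unfolding simple_path_def using p(1) by (rule U.apath_awalk_to_apath)
  moreover have "path_arcs G (U.awalk_to_apath p) \<subseteq> E"
    using U.awalk_to_apath_subset[OF p(1)] p(2) orient_unique unfolding path_arcs_orient by blast
  ultimately show ?thesis by blast
qed

lemma simple_path_walk_cost:
  "simple_path G u p w \<Longrightarrow> walk_cost G r u w (path_arcs G p) (sum r (path_arcs G p))"
proof (induction p arbitrary: u)
  case Nil
  then have "u = w" by (simp add: simple_path_def U.apath_Nil_iff)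
  moreover have "path_arcs G [] = {}" by (simp add: path_arcs_def)
  ultimately show ?case using walk_cost.stay[of G r w] by simp
next
  case (Cons ab p)
  obtain a b where ab: "ab = (a, b)" by (cases ab)
  from Cons.prems ab have *: "(u, b) \<in> parcs (mk_symmetric G)" "a = u" "U.apath b p w"
    "u \<notin> set (U.awalk_verts b p)"
    by (auto simp: simple_path_def U.apath_Cons_iff)
  from *(1) obtain e where e: "orient G e u b" by (auto simp: arc_und_iff)
  have ins: "path_arcs G (ab # p) = insert e (path_arcs G p)"
    using e orient_unique ab *(2) unfolding path_arcs_orient by auto
  \<comment> \<open>The arc \<open>e\<close> is incident to \<open>u\<close>, which a simple path
    never revisits; so the sum over the set of arcs counts each step once.\<close>
  have "e \<notin> path_arcs G p"
  proof
    assume "e \<in> path_arcs G p"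
    then obtain cd where cd: "cd \<in> set p" "orient G e (fst cd) (snd cd)" by (auto simp: path_arcs_orient)
    then have "u = fst cd \<or> u = snd cd" using e by (auto simp: orient_def)
    moreover have "fst cd \<in> set (U.awalk_verts b p)" "snd cd \<in> set (U.awalk_verts b p)"
      using U.awalk_verts_arc1[OF cd(1), of b] U.awalk_verts_arc2[OF U.awalkI_apath[OF *(3)] cd(1)]
      by simp_all
    ultimately show False using *(4) by auto
  qed
  then have "sum r (path_arcs G (ab # p)) = r e + sum r (path_arcs G p)"
    using ins finite_path_arcs by simp
  moreover have "walk_cost G r b w (path_arcs G p) (sum r (path_arcs G p))"
    using Cons.IH *(3) by (simp add: simple_path_def)
  ultimately show ?case using walk_cost.move[OF e] ins by simp
qed

context
  fixes u w assumes uw: "u \<in> verts G" "w \<in> verts G"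
begin

lemma min_path_attained: "\<exists>p. simple_path G u p w \<and> min_path G r u w = sum r (path_arcs G p)"
proof -
  have "min_path G r u w \<in> (\<lambda>p. sum r (path_arcs G p)) ` {p. simple_path G u p w}"
    unfolding min_path_def using finite_simple_paths ex_simple_path[OF uw] by (intro Min_in) auto
  then show ?thesis by auto
qed

lemma min_path_le: "simple_path G u p w \<Longrightarrow> min_path G r u w \<le> sum r (path_arcs G p)"
  unfolding min_path_def using finite_simple_paths by (intro Min_le) auto

lemma min_path_walk: "\<exists>E. walk_cost G r u w E (min_path G r u w)"
  using min_path_attained simple_path_walk_cost by metis

lemma min_path_le_walk_cost:
  assumes r: "\<And>e. e \<in> arcs G \<Longrightarrow> 0 \<le> r e" and walk: "walk_cost G r u w E t"
  shows "min_path G r u w \<le> t"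
proof -
  obtain p where p: "simple_path G u p w" "path_arcs G p \<subseteq> E"
    using simple_path_subset_walk[OF walk uw(2)] by blast
  have "min_path G r u w \<le> sum r (path_arcs G p)" using p(1) by (rule min_path_le)
  also have "\<dots> \<le> sum r E"
    using p(2) walk_cost_finite[OF walk] walk_cost_arcs[OF walk] r by (intro sum_mono2) auto
  also have "\<dots> \<le> t" using walk_cost_ge_sum[OF r walk] by blast
  finally show ?thesis .
qed

text \<open>\<open>f\<close> is the distance to \<open>w\<close>, as an infimum over walks;
  prefixing an arc to a walk gives the Lipschitz bound. Loop erasure identifies its value at
  \<open>u\<close>.\<close>

lemma ex_distance_function:
  assumes r: "\<And>e. e \<in> arcs G \<Longrightarrow> 0 \<le> r e"
  shows "\<exists>f. lip G r f \<and> f w = 0 \<and> f u = min_path G r u w"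
proof -
  define T where "T x = {t. \<exists>E. walk_cost G r x w E t}" for x
  define f where "f x = Inf (T x)" for x
  have nn: "0 \<le> t" if "t \<in> T x" for x t
  proof -
    from that obtain E where E: "walk_cost G r x w E t" by (auto simp: T_def)
    have "0 \<le> sum r E" using walk_cost_arcs[OF E] r by (intro sum_nonneg) auto
    then show ?thesis using walk_cost_ge_sum[OF r E] by linarith
  qed
  have bdd: "bdd_below (T x)" for x using nn by (meson bdd_below.I)
  have ne: "T x \<noteq> {}" if "x \<in> verts G" for x
    using ex_simple_path[OF that uw(2)] simple_path_walk_cost by (fastforce simp: T_def)
  have step: "f x - f y \<le> r e" if "orient G e x y" for e x y
  proof -
    have "f x - r e \<le> t" if t: "t \<in> T y" for t
    proof -
      have "r e + t \<in> T x" using t walk_cost.move[OF \<open>orient G e x y\<close>] unfolding T_def by blast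
      then have "f x \<le> r e + t" unfolding f_def using bdd by (rule cInf_lower)
      then show ?thesis by simp
    qed
    moreover have "y \<in> verts G" using that by (auto simp: orient_def)
    ultimately have "f x - r e \<le> f y" unfolding f_def using ne by (intro cInf_greatest) auto
    then show ?thesis by simp
  qed
  have "lip G r f" unfolding lip_def
  proof
    fix e assume e: "e \<in> arcs G"
    show "\<bar>f (tail G e) - f (head G e)\<bar> \<le> r e"
      using step[of e "tail G e" "head G e"] step[of e "head G e" "tail G e"] e
      by (simp add: orient_def abs_le_iff)
  qed
  moreover have "f w = 0"
  proof (rule antisym)
    have "0 \<in> T w" using walk_cost.stay[of G r w] by (auto simp: T_def)
    then show "f w \<le> 0" unfolding f_def using bdd by (rule cInf_lower)
  qed (use ne[OF uw(2)] nn in \<open>auto simp: f_def intro: cInf_greatest\<close>)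
  moreover have "f u = min_path G r u w"
  proof (rule antisym)
    show "f u \<le> min_path G r u w"
      unfolding f_def using bdd min_path_walk by (intro cInf_lower) (auto simp: T_def)
    show "min_path G r u w \<le> f u"
      unfolding f_def using ne[OF uw(1)] min_path_le_walk_cost[OF r] by (intro cInf_greatest) (auto simp: T_def)
  qed
  ultimately show ?thesis by blast
qed

end

lemma separates_if_paths_meet:
  assumes "w \<in> verts G" "\<And>p. simple_path G u p w \<Longrightarrow> path_arcs G p \<inter> C \<noteq> {}"
  shows "separates G C u w"
  using assms simple_path_subset_walk by (intro separates_if_walks_meet) fast

end

lemma sc_graph_iff: "sc_graph G \<longleftrightarrow> simple_connected G"
  by (auto simp: sc_graph_def sc_graph_axioms_def simple_connected_def)

section \<open>Substitution\<close>

locale wf_system =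
  fixes S :: "('v, 'e) eigs"
  assumes wf: "wf_eigs S"
begin

abbreviation "K \<equiv> num_cols S"

lemma K_pos: "0 < K" and init_less: "init_col S < K"
  using wf by (auto simp: wf_eigs_def)

lemma rule_sc: "i < K \<Longrightarrow> sc_graph (rule S i)"
  using wf by (simp add: wf_eigs_def sc_graph_iff)

lemma rule_fin: "i < K \<Longrightarrow> fin_digraph (rule S i)"
  using rule_sc by (simp add: sc_graph_def digraph_def)

lemma plant: "i < K \<Longrightarrow> plant_pos S i \<in> verts (rule S i)" "i < K \<Longrightarrow> plant_neg S i \<in> verts (rule S i)"
  "i < K \<Longrightarrow> plant_pos S i \<noteq> plant_neg S i"
  using wf by (auto simp: wf_eigs_def)

lemma ecol_less: "i < K \<Longrightarrow> f \<in> arcs (rule S i) \<Longrightarrow> ecol S i f < K"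
  using wf by (auto simp: wf_eigs_def)

lemma Xi_arcs: "e \<in> arcs (Xi S n) \<Longrightarrow> length e = n \<and> acol S e < K"
  by (induction n arbitrary: e) (auto simp: substitute_def init_less ecol_less)

text \<open>The length of its arc name is the level of a new vertex, so the copies made at step
  \<open>n\<close> are disjoint from all earlier vertices.\<close>

lemma Xi_new_length: "V_new e x \<in> verts (Xi S n) \<Longrightarrow> length e < n"
  by (induction n) (auto simp: substitute_def dest: Xi_arcs)

lemma Xi_Suc_tail: "tail (Xi S (Suc n)) (f # e) =
    embed S e (tail (Xi S n) e) (head (Xi S n) e) (tail (rule S (acol S e)) f)"
  and Xi_Suc_head: "head (Xi S (Suc n)) (f # e) =
    embed S e (tail (Xi S n) e) (head (Xi S n) e) (head (rule S (acol S e)) f)"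
  by (simp_all add: substitute_def)

lemma Xi_Suc_arcs: "arcs (Xi S (Suc n)) =
    (\<lambda>(e, f). f # e) ` (SIGMA e:arcs (Xi S n). arcs (rule S (acol S e)))"
  by (auto simp: substitute_def)

lemma Xi_V: "V_pos \<in> verts (Xi S n)" "V_neg \<in> verts (Xi S n)"
  by (induction n) (auto simp: substitute_def)

lemma embed_in_verts:
  assumes "e \<in> arcs (Xi S n)" "x \<in> verts (rule S (acol S e))"
    "tail (Xi S n) e \<in> verts (Xi S n)" "head (Xi S n) e \<in> verts (Xi S n)"
  shows "embed S e (tail (Xi S n) e) (head (Xi S n) e) x \<in> verts (Xi S (Suc n))"
  using assms by (auto simp: embed_def substitute_def)

lemma Xi_fin: "fin_digraph (Xi S n)"
proof (induction n)
  case 0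
  show ?case by unfold_locales auto
next
  case (Suc n)
  interpret G: fin_digraph "Xi S n" by (rule Suc.IH)
  have R: "fin_digraph (rule S (acol S e))" if "e \<in> arcs (Xi S n)" for e
    using Xi_arcs[OF that] rule_fin by blast
  show ?case
  proof
    fix d assume "d \<in> arcs (Xi S (Suc n))"
    then obtain f e where d: "d = f # e" "e \<in> arcs (Xi S n)" "f \<in> arcs (rule S (acol S e))"
      by (auto simp: Xi_Suc_arcs simp del: Xi.simps)
    interpret R: fin_digraph "rule S (acol S e)" by (rule R[OF d(2)])
    show "tail (Xi S (Suc n)) d \<in> verts (Xi S (Suc n))" "head (Xi S (Suc n)) d \<in> verts (Xi S (Suc n))"
      using d by (simp_all only: Xi_Suc_tail Xi_Suc_head) (intro embed_in_verts; simp)+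
  next
    have "verts (Xi S (Suc n)) \<subseteq> verts (Xi S n) \<union>
        (\<Union>e\<in>arcs (Xi S n). V_new e ` verts (rule S (acol S e)))"
      by (auto simp: substitute_def)
    then show "finite (verts (Xi S (Suc n)))"
    proof (rule finite_subset)
      show "finite (verts (Xi S n) \<union> (\<Union>e\<in>arcs (Xi S n). V_new e ` verts (rule S (acol S e))))"
        using fin_digraph.finite_verts[OF R] by simp
    qed
    show "finite (arcs (Xi S (Suc n)))"
      unfolding Xi_Suc_arcs using R fin_digraph.finite_arcs by (intro finite_imageI finite_SigmaI) auto
  qed
qed

lemma sum_Xi_Suc:
  "sum g (arcs (Xi S (Suc n))) = (\<Sum>e\<in>arcs (Xi S n). \<Sum>f\<in>arcs (rule S (acol S e)). g (f # e))"
proof -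
  have "inj_on (\<lambda>(e, f). f # e) A" for A :: "('e list \<times> 'e) set"
    by (auto simp: inj_on_def)
  then have "sum g (arcs (Xi S (Suc n))) =
      (\<Sum>(e, f)\<in>(SIGMA e:arcs (Xi S n). arcs (rule S (acol S e))). g (f # e))"
    unfolding Xi_Suc_arcs by (subst sum.reindex) (auto intro: sum.cong)
  also have "\<dots> = (\<Sum>e\<in>arcs (Xi S n). \<Sum>f\<in>arcs (rule S (acol S e)). g (f # e))"
    using Xi_fin[of n] rule_fin Xi_arcs
    by (intro sum.Sigma[symmetric]) (auto simp: fin_digraph_def fin_digraph_axioms_def)
  finally show ?thesis .
qed

text \<open>Old vertices keep \<open>\<phi>\<close>, new ones take the local function of their copy.
  The default 0 is never reached, since \<open>V_pos\<close> and \<open>V_neg\<close> belong to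
  every graph.\<close>

definition glue :: "nat \<Rightarrow> (('v, 'e) xvert \<Rightarrow> real) \<Rightarrow> ('e list \<Rightarrow> 'v \<Rightarrow> real) \<Rightarrow> ('v, 'e) xvert \<Rightarrow> real" where
  "glue n \<phi> \<psi> v = (if v \<in> verts (Xi S n) then \<phi> v else case v of V_new e x \<Rightarrow> \<psi> e x | _ \<Rightarrow> 0)"

lemma glue_embed:
  assumes "e \<in> arcs (Xi S n)"
    "\<psi> e (plant_pos S (acol S e)) = \<phi> (tail (Xi S n) e)" "\<psi> e (plant_neg S (acol S e)) = \<phi> (head (Xi S n) e)"
  shows "glue n \<phi> \<psi> (embed S e (tail (Xi S n) e) (head (Xi S n) e) x) = \<psi> e x"
proof -
  interpret fin_digraph "Xi S n" by (rule Xi_fin)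
  show ?thesis
    using assms Xi_new_length[of e x n] Xi_arcs[OF assms(1)] by (auto simp: glue_def embed_def)
qed

lemma glue_V: "glue n \<phi> \<psi> V_pos = \<phi> V_pos" "glue n \<phi> \<psi> V_neg = \<phi> V_neg"
  by (simp_all add: glue_def Xi_V)

section \<open>Resistance and distance maps, and their behaviour under one substitution\<close>

definition res_map :: "(nat \<Rightarrow> real) \<Rightarrow> nat \<Rightarrow> real" where
  "res_map x i = eff_res (rule S i) (\<lambda>e. x (ecol S i e)) (plant_pos S i) (plant_neg S i)"

definition dist_map :: "(nat \<Rightarrow> real) \<Rightarrow> nat \<Rightarrow> real" where
  "dist_map x i = min_path (rule S i) (\<lambda>e. x (ecol S i e)) (plant_pos S i) (plant_neg S i)"

lemma ex_rule_potential:
  assumes "\<And>k. k < K \<Longrightarrow> 0 < x k" "i < K"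
  shows "\<exists>\<phi>. weak_potential (rule S i) (\<lambda>e. x (ecol S i e)) (plant_pos S i) (plant_neg S i) \<phi>"
  using assms rule_sc[OF assms(2)] plant ecol_less
  by (intro fin_digraph.ex_weak_potential rule_fin) (auto simp: sc_graph_def sc_graph_axioms_def)

lemma res_map_eq:
  assumes "i < K" "weak_potential (rule S i) (\<lambda>e. x (ecol S i e)) (plant_pos S i) (plant_neg S i) \<phi>"
  shows "res_map x i = \<phi> (plant_pos S i) - \<phi> (plant_neg S i)"
  unfolding res_map_def using assms plant rule_fin by (intro fin_digraph.eff_res_eqI) auto

text \<open>Inside the copy replacing \<open>e\<close>, use the potential of the rule graph scaled by the current
  through \<open>e\<close>.\<close>

lemma weak_potential_Xi_Suc:
  assumes x: "\<And>k. k < K \<Longrightarrow> 0 < x k" and pos: "\<And>k. k < K \<Longrightarrow> res_map x k \<noteq> 0"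
    and \<phi>: "weak_potential (Xi S n) (\<lambda>e. res_map x (acol S e)) V_pos V_neg \<phi>"
  shows "\<exists>\<phi>'. weak_potential (Xi S (Suc n)) (\<lambda>e. x (acol S e)) V_pos V_neg \<phi>' \<and>
    \<phi>' V_pos = \<phi> V_pos \<and> \<phi>' V_neg = \<phi> V_neg"
proof -
  let ?G = "Xi S n"
  let ?wp = "\<lambda>i. weak_potential (rule S i) (\<lambda>e. x (ecol S i e)) (plant_pos S i) (plant_neg S i)"
  have "\<forall>i. \<exists>\<phi>. i < K \<longrightarrow> ?wp i \<phi>"
  proof
    fix i show "\<exists>\<phi>. i < K \<longrightarrow> ?wp i \<phi>"
      using ex_rule_potential[of x i] x by (cases "i < K") auto
  qed
  then obtain \<theta> where \<theta>: "\<And>i. i < K \<Longrightarrow> ?wp i (\<theta> i)"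
    by metis
  define I where "I e = (\<phi> (tail ?G e) - \<phi> (head ?G e)) / res_map x (acol S e)" for e
  define \<psi> where "\<psi> e z = \<phi> (head ?G e) + I e * (\<theta> (acol S e) z - \<theta> (acol S e) (plant_neg S (acol S e)))" for e z
  let ?h = "glue n \<phi> \<psi>"
  have col: "acol S e < K" if "e \<in> arcs ?G" for e using Xi_arcs[OF that] by blast
  have h: "?h (embed S e (tail ?G e) (head ?G e) z) = \<psi> e z" if "e \<in> arcs ?G" for e z
  proof (rule glue_embed[OF that])
    show "\<psi> e (plant_pos S (acol S e)) = \<phi> (tail ?G e)"
      using res_map_eq[OF col \<theta>[OF col], OF that that] pos[OF col[OF that]] by (simp add: \<psi>_def I_def)
  qed (simp add: \<psi>_def)
  have "dirichlet (Xi S (Suc n)) (\<lambda>e. x (acol S e)) g ?h = g V_pos - g V_neg" for g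
  proof -
    \<comment> \<open>The weak equation in the rule graph, tested with \<open>g\<close> restricted
      to the copy, collapses the copy to a single arc of resistance
      \<open>res_map x (acol S e)\<close>.\<close>
    have "(\<Sum>f\<in>arcs (rule S (acol S e)).
        (g (tail (Xi S (Suc n)) (f # e)) - g (head (Xi S (Suc n)) (f # e))) *
        (?h (tail (Xi S (Suc n)) (f # e)) - ?h (head (Xi S (Suc n)) (f # e))) / x (acol S (f # e)))
      = (g (tail ?G e) - g (head ?G e)) * (\<phi> (tail ?G e) - \<phi> (head ?G e)) / res_map x (acol S e)"
      (is "?L = ?R") if e: "e \<in> arcs ?G" for e
    proof -
      let ?i = "acol S e" and ?g = "\<lambda>z. g (embed S e (tail ?G e) (head ?G e) z)"
      have "?L = I e * dirichlet (rule S ?i) (\<lambda>f. x (ecol S ?i f)) ?g (\<theta> ?i)"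
        unfolding dirichlet_def sum_distrib_left Xi_Suc_tail Xi_Suc_head h[OF e]
        by (intro sum.cong) (auto simp: \<psi>_def algebra_simps diff_divide_distrib add_divide_distrib)
      also have "dirichlet (rule S ?i) (\<lambda>f. x (ecol S ?i f)) ?g (\<theta> ?i) = ?g (plant_pos S ?i) - ?g (plant_neg S ?i)"
        using \<theta>[OF col[OF e]] unfolding weak_potential_def by blast
      also have "\<dots> = g (tail ?G e) - g (head ?G e)"
        using plant(3)[OF col[OF e]] by (auto simp: embed_def)
      finally show ?thesis by (simp add: I_def mult.commute)
    qed
    then have "dirichlet (Xi S (Suc n)) (\<lambda>e. x (acol S e)) g ?h = dirichlet ?G (\<lambda>e. res_map x (acol S e)) g \<phi>"
      unfolding dirichlet_def sum_Xi_Suc by (rule sum.cong[OF refl])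
    then show ?thesis using \<phi> by (simp add: weak_potential_def)
  qed
  then have "weak_potential (Xi S (Suc n)) (\<lambda>e. x (acol S e)) V_pos V_neg ?h"
    by (simp add: weak_potential_def)
  then show ?thesis using glue_V by blast
qed

text \<open>Each step is replaced by a cheapest walk through the copy of the rule graph, reversed if
  the arc is traversed backwards.\<close>

lemma walk_cost_Xi_Suc:
  assumes "\<And>k. k < K \<Longrightarrow> 0 < x k"
  shows "walk_cost (Xi S n) (\<lambda>e. dist_map x (acol S e)) a b E t \<Longrightarrow>
    \<exists>E'. walk_cost (Xi S (Suc n)) (\<lambda>e. x (acol S e)) a b E' t"
proof (induction rule: walk_cost.induct)
  case (stay a)
  show ?case by (rule exI) (rule walk_cost.stay)
next
  case (move e a b c E t)
  let ?G = "Xi S n" and ?i = "acol S e"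
  have e: "e \<in> arcs ?G" using move.hyps(1) by (simp add: orient_def)
  then have i: "?i < K" using Xi_arcs by blast
  interpret R: sc_graph "rule S ?i" by (rule rule_sc[OF i])
  let ?emb = "embed S e (tail ?G e) (head ?G e)"
  have emb: "\<exists>E'. walk_cost (Xi S (Suc n)) (\<lambda>e. x (acol S e)) (?emb y) (?emb z) E' t"
    if "walk_cost (rule S ?i) (\<lambda>f. x (ecol S ?i f)) y z E t" for y z E t
    using that
  proof (induction rule: walk_cost.induct)
    case (move f y z w E t)
    have "orient (Xi S (Suc n)) (f # e) (?emb y) (?emb z)"
      using move.hyps(1) e unfolding orient_def Xi_Suc_tail Xi_Suc_head Xi_Suc_arcs by auto
    from walk_cost.move[OF this] move.IH show ?case by (metis acol.simps(2))
  qed (blast intro: walk_cost.stay)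
  obtain E0 where "walk_cost (rule S ?i) (\<lambda>f. x (ecol S ?i f)) (plant_pos S ?i) (plant_neg S ?i) E0 (dist_map x ?i)"
    using R.min_path_walk[OF plant(1,2)[OF i]] unfolding dist_map_def by blast
  from emb[OF this] obtain E1 where
    E1: "walk_cost (Xi S (Suc n)) (\<lambda>e. x (acol S e)) (tail ?G e) (head ?G e) E1 (dist_map x ?i)"
    using plant(3)[OF i] by (auto simp: embed_def)
  then have "\<exists>E1. walk_cost (Xi S (Suc n)) (\<lambda>e. x (acol S e)) a b E1 (dist_map x ?i)"
    using move.hyps(1) walk_cost_sym[OF E1] by (auto simp: orient_def)
  then show ?case using move.IH walk_cost_trans by metis
qed

text \<open>Inside the copy replacing \<open>e\<close>, truncate the distance to the negative planting vertex so that it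
  takes the prescribed values at both planting vertices.\<close>

lemma lip_Xi_Suc:
  assumes x: "\<And>k. k < K \<Longrightarrow> 0 < x k" and \<phi>: "lip (Xi S n) (\<lambda>e. dist_map x (acol S e)) \<phi>"
  shows "\<exists>\<phi>'. lip (Xi S (Suc n)) (\<lambda>e. x (acol S e)) \<phi>' \<and> \<phi>' V_pos = \<phi> V_pos \<and> \<phi>' V_neg = \<phi> V_neg"
proof -
  let ?G = "Xi S n"
  have ex: "\<exists>\<psi>. e \<in> arcs ?G \<longrightarrow> lip (rule S (acol S e)) (\<lambda>f. x (ecol S (acol S e) f)) \<psi> \<and>
      \<psi> (plant_pos S (acol S e)) = \<phi> (tail ?G e) \<and> \<psi> (plant_neg S (acol S e)) = \<phi> (head ?G e)" for e
  proof (cases "e \<in> arcs ?G")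
    case e: True
    let ?i = "acol S e" and ?a = "\<phi> (tail ?G e)" and ?b = "\<phi> (head ?G e)"
    have i: "?i < K" using e Xi_arcs by blast
    interpret R: sc_graph "rule S ?i" by (rule rule_sc[OF i])
    obtain f where f: "lip (rule S ?i) (\<lambda>f. x (ecol S ?i f)) f" "f (plant_neg S ?i) = 0"
      "f (plant_pos S ?i) = dist_map x ?i"
      using R.ex_distance_function[OF plant(1,2)[OF i], of "\<lambda>f. x (ecol S ?i f)"] x ecol_less[OF i]
      unfolding dist_map_def by (auto simp: less_imp_le)
    have d: "\<bar>?a - ?b\<bar> \<le> dist_map x ?i" using \<phi> e by (simp add: lip_def)
    show ?thesis
    \<comment> \<open>The cut-off at \<open>?a\<close> fixes the value at the positive planting
      vertex because \<open>d\<close> says that \<open>f\<close> reaches at least that far; at the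
      negative one \<open>f\<close> vanishes and leaves \<open>?b\<close>.\<close>
    proof (cases "?b \<le> ?a")
      case True
      have "lip (rule S ?i) (\<lambda>f. x (ecol S ?i f)) (\<lambda>z. min (?b + f z) ?a)"
        unfolding lip_def
      proof
        fix g assume "g \<in> arcs (rule S ?i)"
        then show "\<bar>min (?b + f (tail (rule S ?i) g)) ?a - min (?b + f (head (rule S ?i) g)) ?a\<bar> \<le> x (ecol S ?i g)"
          using f(1) unfolding lip_def by (auto simp: min_def abs_le_iff split: if_splits)
      qed
      then show ?thesis using f d True by (intro exI[of _ "\<lambda>z. min (?b + f z) ?a"]) auto
    next
      case False
      have "lip (rule S ?i) (\<lambda>f. x (ecol S ?i f)) (\<lambda>z. max (?b - f z) ?a)"
        unfolding lip_def
      proof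
        fix g assume "g \<in> arcs (rule S ?i)"
        then show "\<bar>max (?b - f (tail (rule S ?i) g)) ?a - max (?b - f (head (rule S ?i) g)) ?a\<bar> \<le> x (ecol S ?i g)"
          using f(1) unfolding lip_def by (auto simp: max_def abs_le_iff split: if_splits)
      qed
      then show ?thesis using f d False by (intro exI[of _ "\<lambda>z. max (?b - f z) ?a"]) auto
    qed
  qed simp
  then obtain \<psi> where \<psi>: "\<And>e. e \<in> arcs ?G \<Longrightarrow> lip (rule S (acol S e)) (\<lambda>f. x (ecol S (acol S e) f)) (\<psi> e)"
    "\<And>e. e \<in> arcs ?G \<Longrightarrow> \<psi> e (plant_pos S (acol S e)) = \<phi> (tail ?G e)"
    "\<And>e. e \<in> arcs ?G \<Longrightarrow> \<psi> e (plant_neg S (acol S e)) = \<phi> (head ?G e)"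
    by metis
  have "lip (Xi S (Suc n)) (\<lambda>e. x (acol S e)) (glue n \<phi> \<psi>)"
    unfolding lip_def
  proof
    fix d assume "d \<in> arcs (Xi S (Suc n))"
    then obtain f e where d: "d = f # e" "e \<in> arcs ?G" "f \<in> arcs (rule S (acol S e))"
      by (auto simp: Xi_Suc_arcs simp del: Xi.simps)
    show "\<bar>glue n \<phi> \<psi> (tail (Xi S (Suc n)) d) - glue n \<phi> \<psi> (head (Xi S (Suc n)) d)\<bar> \<le> x (acol S d)"
      unfolding d(1) Xi_Suc_tail Xi_Suc_head glue_embed[of e n \<psi> \<phi>, OF d(2) \<psi>(2,3)[OF d(2)]]
      using \<psi>(1)[OF d(2)] d(3) by (simp add: lip_def)
  qed
  then show ?thesis using glue_V by blast
qed

end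

section \<open>Growth rates\<close>

lemma weak_potential_swap:
  "weak_potential G r u w \<phi> \<Longrightarrow> weak_potential G r w u (\<lambda>x. - \<phi> x)"
  unfolding weak_potential_def dirichlet_def
  by (simp add: algebra_simps diff_divide_distrib add_divide_distrib sum_subtractf sum.distrib)

lemma sum_card_colours:
  fixes x :: "nat \<Rightarrow> real"
  assumes "finite P" "c ` P \<subseteq> {..<K}"
  shows "(\<Sum>j<K. real (card {e \<in> P. c e = j}) * x j) = (\<Sum>e\<in>P. x (c e))"
proof -
  have "(\<Sum>e\<in>P. x (c e)) = (\<Sum>j<K. \<Sum>e | e \<in> P \<and> c e = j. x (c e))"
    using assms by (intro sum.group[symmetric]) auto
  also have "\<dots> = (\<Sum>j<K. \<Sum>e | e \<in> P \<and> c e = j. x j)"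
    by (intro sum.cong) auto
  finally show ?thesis by simp
qed

text \<open>The value \<open>\<rho>\<close> lies in the spectrum, whence one inequality. For the
  other, let \<open>t * v\<close> be the least multiple dominating the moduli of an eigenvector
  \<open>w\<close> and compare at the contact coordinate, using nonnegativity of
  \<open>D\<close>.\<close>

lemma spectral_radius_eq_positive_eigenvalue:
  fixes D :: "nat mat" and v :: "nat \<Rightarrow> real"
  assumes D: "D \<in> carrier_mat K K" and K: "0 < K"
    and v: "\<And>k. k < K \<Longrightarrow> 0 < v k" and \<rho>: "0 < \<rho>"
    and ev: "\<And>i. i < K \<Longrightarrow> (\<Sum>j<K. real (D $$ (i, j)) * v j) = \<rho> * v i"
  shows "spectral_radius (map_mat of_nat D) = \<rho>"
proof (rule antisym)
  let ?A = "map_mat of_nat D :: complex mat"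
  have A: "?A \<in> carrier_mat K K" using D by simp
  have mv: "(?A *\<^sub>v w) $ i = (\<Sum>j<K. of_nat (D $$ (i, j)) * w $ j)" if "w \<in> carrier_vec K" "i < K" for w i
    using that D by (simp add: scalar_prod_def lessThan_atLeast0)
  let ?w = "vec K (\<lambda>k. complex_of_real (v k))"
  have "?A *\<^sub>v ?w = complex_of_real \<rho> \<cdot>\<^sub>v ?w"
  proof (rule eq_vecI)
    fix i assume "i < dim_vec (complex_of_real \<rho> \<cdot>\<^sub>v ?w)"
    then have i: "i < K" by simp
    have "(?A *\<^sub>v ?w) $ i = complex_of_real (\<Sum>j<K. real (D $$ (i, j)) * v j)"
      using mv[of ?w i] i by simp
    then show "(?A *\<^sub>v ?w) $ i = (complex_of_real \<rho> \<cdot>\<^sub>v ?w) $ i" using ev[OF i] i by simp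
  qed (use D in simp)
  moreover have "?w \<noteq> 0\<^sub>v K"
  proof
    assume "?w = 0\<^sub>v K"
    then have "?w $ 0 = 0" using K by simp
    then show False using v[OF K] K by simp
  qed
  ultimately have "eigenvector ?A ?w (complex_of_real \<rho>)"
    using D by (simp add: eigenvector_def)
  then have "norm (complex_of_real \<rho>) \<in> norm ` spectrum ?A"
    unfolding spectrum_def eigenvalue_def by blast
  then have "norm (complex_of_real \<rho>) \<le> spectral_radius ?A"
    by (rule spectral_radius_mem_max(2)[OF A K])
  then show "\<rho> \<le> spectral_radius ?A" using \<rho> by simp
next
  let ?A = "map_mat of_nat D :: complex mat"
  have A: "?A \<in> carrier_mat K K" using D by simp
  obtain \<mu> w where \<mu>: "spectral_radius ?A = norm \<mu>" "eigenvector ?A w \<mu>"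
    using spectral_radius_mem_max(1)[OF A K] by (auto simp: spectrum_def eigenvalue_def)
  then have w: "w \<in> carrier_vec K" "w \<noteq> 0\<^sub>v K" "?A *\<^sub>v w = \<mu> \<cdot>\<^sub>v w"
    using D by (auto simp: eigenvector_def)
  have "\<forall>k<K. 0 < v k" using v by blast
  from tight_ratio_bound[OF K this, of "\<lambda>k. norm (w $ k)"] obtain t i
    where t: "i < K" "norm (w $ i) = t * v i" "\<And>k. k < K \<Longrightarrow> norm (w $ k) \<le> t * v k"
    by blast
  obtain k where k: "k < K" "w $ k \<noteq> 0"
    using w(1,2) by (metis carrier_vecD dim_vec eq_vecI index_zero_vec(1) zero_carrier_vec)
  have "0 < norm (w $ k)" using k(2) by simp
  also have "\<dots> \<le> t * v k" using t(3) k(1) by blast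
  finally have t0: "0 < t" using v[OF k(1)] by (simp add: zero_less_mult_iff)
  have "norm \<mu> * norm (w $ i) = norm ((?A *\<^sub>v w) $ i)"
    using w(1,3) t(1) by (simp add: norm_mult)
  also have "(?A *\<^sub>v w) $ i = (\<Sum>j<K. of_nat (D $$ (i, j)) * w $ j)"
    using w(1) t(1) D by (simp add: scalar_prod_def lessThan_atLeast0)
  also have "norm \<dots> \<le> (\<Sum>j<K. real (D $$ (i, j)) * norm (w $ j))"
    by (rule order_trans[OF norm_sum]) (simp add: norm_mult)
  also have "\<dots> \<le> (\<Sum>j<K. real (D $$ (i, j)) * (t * v j))"
    using t(3) by (intro sum_mono mult_left_mono) auto
  also have "\<dots> = t * (\<Sum>j<K. real (D $$ (i, j)) * v j)"
    by (simp add: sum_distrib_left mult_ac)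
  also have "\<dots> = \<rho> * norm (w $ i)" using ev[OF t(1)] t(2) by simp
  finally have "norm \<mu> \<le> \<rho>" using t(2) t0 v[OF t(1)] by simp
  then show "spectral_radius ?A \<le> \<rho>" using \<mu>(1) by simp
qed

text \<open>The constant is 1 because positive natural entries are at least 1.\<close>

lemma cone_map_positive_matrix:
  fixes D :: "nat mat"
  assumes "0 < K" and D: "\<And>i j. i < K \<Longrightarrow> j < K \<Longrightarrow> 0 < D $$ (i, j)"
  shows "cone_map K (\<lambda>x i. \<Sum>j<K. real (D $$ (i, j)) * x j) 1"
proof
  fix x y :: "nat \<Rightarrow> real" and i j
  assume x: "\<And>k. k < K \<Longrightarrow> 0 < x k" and le: "\<And>k. k < K \<Longrightarrow> x k \<le> y k" and i: "i < K"
  show "(\<Sum>j<K. real (D $$ (i, j)) * x j) \<le> (\<Sum>j<K. real (D $$ (i, j)) * y j)"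
    using le by (intro sum_mono mult_left_mono) auto
  assume j: "j < K" "x j < y j"
  show "(\<Sum>j<K. real (D $$ (i, j)) * x j) < (\<Sum>j<K. real (D $$ (i, j)) * y j)"
    using le j D[OF i j(1)] by (intro sum_strict_mono_ex1 ballI mult_left_mono bexI[of _ j]) auto
next
  fix x :: "nat \<Rightarrow> real" and i j
  assume x: "\<And>k. k < K \<Longrightarrow> 0 < x k" and i: "i < K" "j < K"
  have "1 * x j \<le> real (D $$ (i, j)) * x j"
    using D[OF i] x[OF i(2)] by (intro mult_right_mono) auto
  also have "\<dots> \<le> (\<Sum>j<K. real (D $$ (i, j)) * x j)"
    using i(2) x by (intro member_le_sum) (auto simp: less_imp_le)
  finally show "1 * x j \<le> (\<Sum>j<K. real (D $$ (i, j)) * x j)" .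
qed (use assms(1) in \<open>simp_all add: sum_distrib_left mult_ac\<close>)

section \<open>Path choices, and the two maps as cone maps\<close>

locale positive_system = wf_system S for S :: "('v, 'e) eigs" +
  assumes dist_pos: "distance_positive S"
begin

lemma ex_rule_path: "i < K \<Longrightarrow> \<exists>p. simple_path (rule S i) (plant_pos S i) p (plant_neg S i)"
  using sc_graph.ex_simple_path[OF rule_sc] plant by blast

definition path_matrix :: "(nat \<Rightarrow> ('v \<times> 'v) list) \<Rightarrow> nat mat" where
  "path_matrix p = mat K K (\<lambda>(i, j). card {e \<in> path_arcs (rule S i) (p i). ecol S i e = j})"

definition path_choices :: "(nat \<Rightarrow> ('v \<times> 'v) list) set" where
  "path_choices = {p. \<forall>i<K. simple_path (rule S i) (plant_pos S i) (p i) (plant_neg S i)}"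

lemma distance_matrices_eq: "distance_matrices S = path_matrix ` path_choices"
  unfolding distance_matrices_def path_matrix_def path_choices_def by (simp only: setcompr_eq_image)

lemma path_matrix_carrier: "path_matrix p \<in> carrier_mat K K"
  by (simp add: path_matrix_def)

lemma path_matrix_pos: "p \<in> path_choices \<Longrightarrow> i < K \<Longrightarrow> j < K \<Longrightarrow> 0 < path_matrix p $$ (i, j)"
  using dist_pos by (simp add: distance_positive_def distance_matrices_eq)

lemma ex_path_choice: "\<exists>p. p \<in> path_choices"
proof -
  have "\<forall>i. \<exists>p. i < K \<longrightarrow> simple_path (rule S i) (plant_pos S i) p (plant_neg S i)"
    using ex_rule_path by blast
  then show ?thesis unfolding path_choices_def by (simp only: choice_iff) blast
qed

text \<open>Any path occurs as row \<open>i\<close> of some distance matrix, the other rows being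
  filled arbitrarily; positivity of the entry at \<open>j\<close> is the claim.\<close>

lemma path_colour:
  assumes p: "simple_path (rule S i) (plant_pos S i) p (plant_neg S i)" and ij: "i < K" "j < K"
  shows "\<exists>e\<in>path_arcs (rule S i) p. ecol S i e = j"
proof -
  obtain q where "q \<in> path_choices" using ex_path_choice by blast
  then have "q(i := p) \<in> path_choices" using p by (simp add: path_choices_def)
  from path_matrix_pos[OF this ij] have "0 < card {e \<in> path_arcs (rule S i) p. ecol S i e = j}"
    using ij by (simp add: path_matrix_def)
  then show ?thesis by (auto simp: card_gt_0_iff)
qed

lemma path_arcs_colours: "i < K \<Longrightarrow> ecol S i ` path_arcs (rule S i) p \<subseteq> {..<K}"
  using ecol_less by (auto simp: path_arcs_def)

lemma path_matrix_row:
  assumes "i < K"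
  shows "(\<Sum>j<K. real (path_matrix p $$ (i, j)) * x j) = (\<Sum>e\<in>path_arcs (rule S i) (p i). x (ecol S i e))"
proof -
  have "(\<Sum>j<K. real (path_matrix p $$ (i, j)) * x j) =
      (\<Sum>j<K. real (card {e \<in> path_arcs (rule S i) (p i). ecol S i e = j}) * x j)"
    using assms by (intro sum.cong) (auto simp: path_matrix_def)
  also have "\<dots> = (\<Sum>e\<in>path_arcs (rule S i) (p i). x (ecol S i e))"
    using sc_graph.finite_path_arcs[OF rule_sc[OF assms]] path_arcs_colours[OF assms] by (rule sum_card_colours)
  finally show ?thesis .
qed

text \<open>\<open>path_choices\<close> is infinite, as choices at indices from \<open>K\<close> on
  are free; restricting them to indices below \<open>K\<close> leaves the matrix unchanged.\<close>

lemma finite_distance_matrices: "finite (distance_matrices S)"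
proof -
  let ?P = "\<lambda>i. {p. simple_path (rule S i) (plant_pos S i) p (plant_neg S i)}"
  have "distance_matrices S \<subseteq> path_matrix ` (PiE {..<K} ?P)"
  proof
    fix D assume "D \<in> distance_matrices S"
    then obtain p where p: "p \<in> path_choices" "D = path_matrix p" by (auto simp: distance_matrices_eq)
    have "D = path_matrix (restrict p {..<K})" unfolding p(2) path_matrix_def by (rule cong_mat) auto
    moreover have "restrict p {..<K} \<in> PiE {..<K} ?P" using p(1) by (auto simp: path_choices_def)
    ultimately show "D \<in> path_matrix ` (PiE {..<K} ?P)" by blast
  qed
  moreover have "finite (PiE {..<K} ?P)"
    using sc_graph.finite_simple_paths[OF rule_sc] by (intro finite_PiE) auto
  ultimately show ?thesis using finite_subset by blast
qed

lemma dist_map_attained: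
  assumes "i < K"
  shows "\<exists>p. simple_path (rule S i) (plant_pos S i) p (plant_neg S i) \<and>
    dist_map x i = (\<Sum>e\<in>path_arcs (rule S i) p. x (ecol S i e))"
  unfolding dist_map_def using sc_graph.min_path_attained[OF rule_sc[OF assms] plant(1,2)[OF assms]] .

lemma dist_map_le:
  assumes "i < K" "simple_path (rule S i) (plant_pos S i) p (plant_neg S i)"
  shows "dist_map x i \<le> (\<Sum>e\<in>path_arcs (rule S i) p. x (ecol S i e))"
  unfolding dist_map_def using sc_graph.min_path_le[OF rule_sc[OF assms(1)] plant(1,2)[OF assms(1)] assms(2)] .

text \<open>Rows are chosen independently, so the minimising paths of all rule graphs assemble into
  one matrix.\<close>

lemma dist_map_choice:
  "\<exists>p\<in>path_choices. \<forall>i<K. dist_map x i = (\<Sum>j<K. real (path_matrix p $$ (i, j)) * x j)"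
proof -
  have "\<forall>i. \<exists>p. i < K \<longrightarrow> simple_path (rule S i) (plant_pos S i) p (plant_neg S i) \<and>
      dist_map x i = (\<Sum>e\<in>path_arcs (rule S i) p. x (ecol S i e))"
    using dist_map_attained by blast
  then obtain p where "\<forall>i. i < K \<longrightarrow> simple_path (rule S i) (plant_pos S i) (p i) (plant_neg S i) \<and>
      dist_map x i = (\<Sum>e\<in>path_arcs (rule S i) (p i). x (ecol S i e))"
    unfolding choice_iff by blast
  then show ?thesis using path_matrix_row[of _ p x] by (intro bexI[of _ p]) (auto simp: path_choices_def)
qed

lemma dist_map_le_matrix:
  "p \<in> path_choices \<Longrightarrow> i < K \<Longrightarrow> dist_map x i \<le> (\<Sum>j<K. real (path_matrix p $$ (i, j)) * x j)"
  using dist_map_le[of i "p i" x] by (simp add: path_matrix_row path_choices_def)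

text \<open>The matrix that is optimal for the larger vector \<open>y\<close> remains admissible for
  \<open>x\<close>, so both monotonicity claims reduce to those of one fixed positive
  matrix.\<close>

sublocale dist: cone_map K dist_map 1
proof
  show "0 < K" by (rule K_pos)
  have le: "dist_map (\<lambda>k. t * x k) i \<le> t * dist_map x i" if "0 < t" "i < K" for t x i
    using dist_map_attained[OF that(2), of x] dist_map_le[OF that(2), of _ "\<lambda>k. t * x k"]
    by (auto simp: sum_distrib_left)
  fix t :: real and x i
  assume t: "0 < t" "i < K"
  \<comment> \<open>The inequality for the factor \<open>1 / t\<close> at \<open>t * x\<close> is
    the missing converse.\<close>
  have "dist_map (\<lambda>k. 1 / t * (t * x k)) i \<le> 1 / t * dist_map (\<lambda>k. t * x k) i"
    using t by (intro le) auto
  then have "t * dist_map x i \<le> dist_map (\<lambda>k. t * x k) i" using t(1) by (simp add: field_simps)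
  with le[OF t] show "dist_map (\<lambda>k. t * x k) i = t * dist_map x i" by (rule antisym)
next
  fix x y :: "nat \<Rightarrow> real" and i j
  assume x: "\<And>k. k < K \<Longrightarrow> 0 < x k" and le: "\<And>k. k < K \<Longrightarrow> x k \<le> y k" and i: "i < K"
  obtain p where p: "p \<in> path_choices" "dist_map y i = (\<Sum>j<K. real (path_matrix p $$ (i, j)) * y j)"
    using dist_map_choice i by blast
  interpret D: cone_map K "\<lambda>x i. \<Sum>j<K. real (path_matrix p $$ (i, j)) * x j" 1
    by (rule cone_map_positive_matrix[OF K_pos path_matrix_pos[OF p(1)]])
  show "dist_map x i \<le> dist_map y i"
    using dist_map_le_matrix[OF p(1) i, of x] D.mono[of x y i] x le i p(2) by auto
  assume j: "j < K" "x j < y j"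
  show "dist_map x i < dist_map y i"
    using dist_map_le_matrix[OF p(1) i, of x] D.strict[of x y j i] x le i j p(2) by auto
next
  fix x :: "nat \<Rightarrow> real" and i j
  assume x: "\<And>k. k < K \<Longrightarrow> 0 < x k" and ij: "i < K" "j < K"
  obtain p where p: "p \<in> path_choices" "dist_map x i = (\<Sum>j<K. real (path_matrix p $$ (i, j)) * x j)"
    using dist_map_choice ij(1) by blast
  interpret D: cone_map K "\<lambda>x i. \<Sum>j<K. real (path_matrix p $$ (i, j)) * x j" 1
    by (rule cone_map_positive_matrix[OF K_pos path_matrix_pos[OF p(1)]])
  show "1 * x j \<le> dist_map x i" using D.lower[of x i j] x ij p(2) by auto
qed simp

lemma colour_separates:
  assumes "i < K" "j < K"
  shows "separates (rule S i) {e. ecol S i e = j} (plant_pos S i) (plant_neg S i)"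
  using path_colour[OF _ assms]
  by (intro sc_graph.separates_if_paths_meet[OF rule_sc[OF assms(1)]] plant(2)[OF assms(1)]) blast

definition num_arcs :: nat where
  "num_arcs = (\<Sum>i<K. card (arcs (rule S i)))"

text \<open>The cut formed by a colour bounds the resistance below by its weight over the number of
  arcs of the rule graph; \<open>num_arcs\<close> makes the constant uniform over the rule
  graphs.\<close>

sublocale res: cone_map K res_map "1 / num_arcs"
proof
  have card_le: "card (arcs (rule S i)) \<le> num_arcs" if "i < K" for i
    unfolding num_arcs_def using that by (intro member_le_sum) auto
  have card_pos: "0 < card (arcs (rule S i))" if i: "i < K" for i
  proof -
    obtain p where "simple_path (rule S i) (plant_pos S i) p (plant_neg S i)" using ex_rule_path[OF i] by blast
    then have "arcs (rule S i) \<noteq> {}" using path_colour[OF _ i i] by (fastforce simp: path_arcs_def)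
    then show ?thesis using fin_digraph.finite_arcs[OF rule_fin[OF i]] by (simp add: card_gt_0_iff)
  qed
  show "0 < 1 / real num_arcs" using card_le[OF K_pos] card_pos[OF K_pos] by simp
  {
    fix x :: "nat \<Rightarrow> real" and i j
    assume x: "\<And>k. k < K \<Longrightarrow> 0 < x k" and ij: "i < K" "j < K"
    obtain \<phi> where \<phi>: "weak_potential (rule S i) (\<lambda>e. x (ecol S i e)) (plant_pos S i) (plant_neg S i) \<phi>"
      using ex_rule_potential[of x i] x ij(1) by blast
    have "x j / card (arcs (rule S i)) \<le> res_map x i"
      unfolding res_map_eq[OF ij(1) \<phi>]
      by (rule fin_digraph.separates_drop_ge[OF rule_fin[OF ij(1)] colour_separates[OF ij] _ \<phi>])
        (use x ij ecol_less in auto)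
    moreover have "1 / real num_arcs * x j \<le> x j / card (arcs (rule S i))"
      using card_le[OF ij(1)] card_pos[OF ij(1)] x[OF ij(2)] by (simp add: frac_le)
    ultimately show "1 / real num_arcs * x j \<le> res_map x i" by simp
  }
  {
    fix t :: real and x :: "nat \<Rightarrow> real" and i
    assume t: "0 < t" and x: "\<And>k. k < K \<Longrightarrow> 0 < x k" and i: "i < K"
    obtain \<phi> where \<phi>: "weak_potential (rule S i) (\<lambda>e. x (ecol S i e)) (plant_pos S i) (plant_neg S i) \<phi>"
      using ex_rule_potential[of x i] x i by blast
    have "weak_potential (rule S i) (\<lambda>e. t * x (ecol S i e)) (plant_pos S i) (plant_neg S i) (\<lambda>z. t * \<phi> z)"
      using weak_potential_scale[OF \<phi>] t by simp
    then show "res_map (\<lambda>k. t * x k) i = t * res_map x i"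
      using res_map_eq[OF i \<phi>] res_map_eq[OF i, of "\<lambda>k. t * x k"] by (simp add: right_diff_distrib)
  }
  fix x y :: "nat \<Rightarrow> real" and i j
  assume x: "\<And>k. k < K \<Longrightarrow> 0 < x k" and le: "\<And>k. k < K \<Longrightarrow> x k \<le> y k" and i: "i < K"
  have y: "0 < y k" if "k < K" for k using x[OF that] le[OF that] by linarith
  obtain \<phi> where \<phi>: "weak_potential (rule S i) (\<lambda>e. x (ecol S i e)) (plant_pos S i) (plant_neg S i) \<phi>"
    using ex_rule_potential[of x i] x i by blast
  obtain \<psi> where \<psi>: "weak_potential (rule S i) (\<lambda>e. y (ecol S i e)) (plant_pos S i) (plant_neg S i) \<psi>"
    using ex_rule_potential[of y i] y i by blast
  show "res_map x i \<le> res_map y i"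
    unfolding res_map_eq[OF i \<phi>] res_map_eq[OF i \<psi>]
    by (rule weak_potential_drop_mono[OF _ _ \<phi> \<psi>]) (use x le ecol_less[OF i] in auto)
  assume j: "j < K" "x j < y j"
  \<comment> \<open>Current must cross the cut of colour \<open>j\<close>, so some arc whose
    resistance has grown carries current.\<close>
  obtain e where e: "e \<in> arcs (rule S i)" "ecol S i e = j" "\<phi> (tail (rule S i) e) \<noteq> \<phi> (head (rule S i) e)"
    using separates_drop_nonzero[OF colour_separates[OF i j(1)] \<phi>] by auto
  show "res_map x i < res_map y i"
    unfolding res_map_eq[OF i \<phi>] res_map_eq[OF i \<psi>]
    by (rule fin_digraph.weak_potential_drop_strict_mono[OF rule_fin[OF i] _ _ e(1) _ e(3) \<phi> \<psi>])
      (use x le ecol_less[OF i] e j in auto)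
qed (rule K_pos)

section \<open>Resistance and distance in the n-th graph\<close>

lemma ex_Xi_potential:
  "(\<And>k. k < K \<Longrightarrow> 0 < x k) \<Longrightarrow>
    \<exists>\<phi>. weak_potential (Xi S n) (\<lambda>e. x (acol S e)) V_pos V_neg \<phi> \<and>
      \<phi> V_pos - \<phi> V_neg = (res_map ^^ n) x (init_col S)"
proof (induction n arbitrary: x)
  case 0
  let ?\<phi> = "\<lambda>v. if v = V_pos then x (init_col S) else 0"
  have "weak_potential (Xi S 0) (\<lambda>e. x (acol S e)) V_pos V_neg ?\<phi>"
    using 0[OF init_less] by (simp add: weak_potential_def dirichlet_def)
  then show ?case by (intro exI[of _ ?\<phi>]) simp
next
  case (Suc n)
  have pos: "0 < res_map x k" if "k < K" for k using res.pos Suc.prems that by blast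
  \<comment> \<open>The last substitution is undone first, turning weights \<open>x\<close> into
    \<open>res_map x\<close>; this is why the induction is over all \<open>x\<close>.\<close>
  obtain \<phi> where \<phi>: "weak_potential (Xi S n) (\<lambda>e. res_map x (acol S e)) V_pos V_neg \<phi>"
    "\<phi> V_pos - \<phi> V_neg = (res_map ^^ n) (res_map x) (init_col S)"
    using Suc.IH[of "res_map x"] pos by blast
  have "res_map x k \<noteq> 0" if "k < K" for k using pos[OF that] by simp
  from weak_potential_Xi_Suc[OF Suc.prems this \<phi>(1)] obtain \<phi>'
    where "weak_potential (Xi S (Suc n)) (\<lambda>e. x (acol S e)) V_pos V_neg \<phi>'"
      "\<phi>' V_pos = \<phi> V_pos" "\<phi>' V_neg = \<phi> V_neg" by blast
  then show ?case using \<phi>(2) by (intro exI[of _ \<phi>']) (simp add: funpow_swap1 del: Xi.simps)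
qed

lemma ex_Xi_walk:
  "(\<And>k. k < K \<Longrightarrow> 0 < x k) \<Longrightarrow>
    \<exists>E. walk_cost (Xi S n) (\<lambda>e. x (acol S e)) V_pos V_neg E ((dist_map ^^ n) x (init_col S))"
proof (induction n arbitrary: x)
  case 0
  have "orient (Xi S 0) [] V_pos V_neg" by (simp add: orient_def)
  from walk_cost.move[OF this walk_cost.stay, of "\<lambda>e. x (acol S e)"] show ?case by auto
next
  case (Suc n)
  have pos: "0 < dist_map x k" if "k < K" for k using dist.pos Suc.prems that by blast
  obtain E where "walk_cost (Xi S n) (\<lambda>e. dist_map x (acol S e)) V_pos V_neg E
      ((dist_map ^^ n) (dist_map x) (init_col S))"
    using Suc.IH[of "dist_map x"] pos by blast
  from walk_cost_Xi_Suc[OF Suc.prems this] show ?case by (simp add: funpow_swap1 del: Xi.simps)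
qed

lemma ex_Xi_lip:
  "(\<And>k. k < K \<Longrightarrow> 0 < x k) \<Longrightarrow>
    \<exists>f. lip (Xi S n) (\<lambda>e. x (acol S e)) f \<and> f V_pos - f V_neg = (dist_map ^^ n) x (init_col S)"
proof (induction n arbitrary: x)
  case 0
  let ?f = "\<lambda>v. if v = V_pos then x (init_col S) else 0"
  have "lip (Xi S 0) (\<lambda>e. x (acol S e)) ?f"
    using 0[OF init_less] by (simp add: lip_def)
  then show ?case by (intro exI[of _ ?f]) simp
next
  case (Suc n)
  have pos: "0 < dist_map x k" if "k < K" for k using dist.pos Suc.prems that by blast
  obtain f where f: "lip (Xi S n) (\<lambda>e. dist_map x (acol S e)) f"
    "f V_pos - f V_neg = (dist_map ^^ n) (dist_map x) (init_col S)"
    using Suc.IH[of "dist_map x"] pos by blast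
  from lip_Xi_Suc[OF Suc.prems f(1)] obtain f'
    where "lip (Xi S (Suc n)) (\<lambda>e. x (acol S e)) f'" "f' V_pos = f V_pos" "f' V_neg = f V_neg" by blast
  then show ?case using f(2) by (intro exI[of _ f']) (simp add: funpow_swap1 del: Xi.simps)
qed

lemma eff_res_Xi:
  assumes "u \<in> {V_pos, V_neg}" "w \<in> {V_pos, V_neg}" "u \<noteq> w"
  shows "eff_res (Xi S n) (\<lambda>_. 1) u w = (res_map ^^ n) (\<lambda>_. 1) (init_col S)"
proof -
  interpret fin_digraph "Xi S n" by (rule Xi_fin)
  obtain \<phi> where \<phi>: "weak_potential (Xi S n) (\<lambda>_. 1) V_pos V_neg \<phi>"
    "\<phi> V_pos - \<phi> V_neg = (res_map ^^ n) (\<lambda>_. 1) (init_col S)"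
    using ex_Xi_potential[of "\<lambda>_. 1" n] by auto
  have "eff_res (Xi S n) (\<lambda>_. 1) V_pos V_neg = \<phi> V_pos - \<phi> V_neg"
    by (rule eff_res_eqI[OF Xi_V \<phi>(1)])
  moreover have "eff_res (Xi S n) (\<lambda>_. 1) V_neg V_pos = - \<phi> V_neg - - \<phi> V_pos"
    by (rule eff_res_eqI[OF Xi_V(2,1) weak_potential_swap[OF \<phi>(1)]])
  ultimately show ?thesis using assms \<phi>(2) by auto
qed

lemma graph_dist_Xi:
  assumes "u \<in> {V_pos, V_neg}" "w \<in> {V_pos, V_neg}" "u \<noteq> w"
  shows "real (graph_dist (Xi S n) u w) = (dist_map ^^ n) (\<lambda>_. 1) (init_col S)"
proof -
  interpret fin_digraph "Xi S n" by (rule Xi_fin)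
  let ?d = "(dist_map ^^ n) (\<lambda>_. 1) (init_col S)"
  obtain E where E: "walk_cost (Xi S n) (\<lambda>_. 1) V_pos V_neg E ?d"
    using ex_Xi_walk[of "\<lambda>_. 1" n] by auto
  obtain f where f: "lip (Xi S n) (\<lambda>_. 1) f" "f V_pos - f V_neg = ?d"
    using ex_Xi_lip[of "\<lambda>_. 1" n] by auto
  have f': "lip (Xi S n) (\<lambda>_. 1) (\<lambda>v. - f v)" using f(1) by (auto simp: lip_def abs_minus_commute)
  have "real (graph_dist (Xi S n) V_pos V_neg) = ?d"
    using f(2) by (intro graph_dist_eqI[OF Xi_V(2) E f(1)]) simp
  moreover have "real (graph_dist (Xi S n) V_neg V_pos) = ?d"
    using f(2) by (intro graph_dist_eqI[OF Xi_V(1) walk_cost_sym[OF E] f']) simp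
  ultimately show ?thesis using assms by auto
qed

section \<open>Identification of the eigenvalues and the limit\<close>

lemma rho_Psi_eq:
  assumes "0 < \<rho>" "\<And>k. k < K \<Longrightarrow> 0 < v k" "\<And>k. k < K \<Longrightarrow> res_map v k = \<rho> * v k"
  shows "rho_Psi S = \<rho>"
  unfolding rho_Psi_def
proof (rule the_equality)
  have Psi: "Psi S x = vec K (res_map (($) x))" for x
    by (rule eq_vecI) (simp_all add: Psi_def res_map_def)
  \<comment> \<open>Beyond \<open>K\<close> the entries of \<open>vec K v\<close> are unrelated to
    \<open>v\<close>, so monotonicity is used both ways again.\<close>
  have "res_map (($) (vec K v)) k = res_map v k" if "k < K" for k
    using assms(2) that by (intro antisym res.mono) auto
  then have "Psi S (vec K v) = \<rho> \<cdot>\<^sub>v vec K v"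
    using assms(3) by (auto simp: Psi)
  then show "0 < \<rho> \<and> (\<exists>v\<in>carrier_vec K. (\<forall>i<K. 0 < v $ i) \<and> Psi S v = \<rho> \<cdot>\<^sub>v v)"
    using assms(1,2) by (intro conjI bexI[of _ "vec K v"]) auto
  fix \<sigma> assume "0 < \<sigma> \<and> (\<exists>v\<in>carrier_vec K. (\<forall>i<K. 0 < v $ i) \<and> Psi S v = \<sigma> \<cdot>\<^sub>v v)"
  then obtain w where w: "w \<in> carrier_vec K" "\<And>i. i < K \<Longrightarrow> 0 < w $ i" "Psi S w = \<sigma> \<cdot>\<^sub>v w" by blast
  have ev: "res_map (($) w) k = \<sigma> * w $ k" if "k < K" for k
  proof -
    have "Psi S w $ k = (\<sigma> \<cdot>\<^sub>v w) $ k" using w(3) by simp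
    then show ?thesis using that w(1) by (simp add: Psi)
  qed
  \<comment> \<open>Each eigenvector serves once as sub- and once as super-eigenvector.\<close>
  show "\<sigma> = \<rho>"
  proof (rule antisym)
    show "\<sigma> \<le> \<rho>"
      by (rule res.sub_super_eigenvalue_le[of "($) w" \<sigma> v \<rho>]) (simp_all add: ev w(2) assms(2,3))
    show "\<rho> \<le> \<sigma>"
      by (rule res.sub_super_eigenvalue_le[of v \<rho> "($) w" \<sigma>]) (simp_all add: ev w(2) assms(2,3))
  qed
qed

text \<open>The matrix optimal at \<open>v\<close> has \<open>v\<close> as a positive eigenvector,
  so \<open>\<rho>\<close> is attained. For any other distance matrix \<open>v\<close> is a
  sub-eigenvector with factor \<open>\<rho>\<close>, so its spectral radius is at least
  \<open>\<rho>\<close>.\<close>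

lemma rho_min_eq:
  assumes \<rho>: "0 < \<rho>" and v: "\<And>k. k < K \<Longrightarrow> 0 < v k" "\<And>k. k < K \<Longrightarrow> dist_map v k = \<rho> * v k"
  shows "rho_min (distance_matrices S) = \<rho>"
  unfolding rho_min_def
proof (rule Min_eqI)
  show "finite ((\<lambda>D. spectral_radius (map_mat of_nat D)) ` distance_matrices S)"
    using finite_distance_matrices by simp
  obtain p where p: "p \<in> path_choices" "\<forall>i<K. dist_map v i = (\<Sum>j<K. real (path_matrix p $$ (i, j)) * v j)"
    using dist_map_choice by blast
  have "spectral_radius (map_mat of_nat (path_matrix p)) = \<rho>"
    using p(2) v \<rho> by (intro spectral_radius_eq_positive_eigenvalue[OF path_matrix_carrier K_pos, of v]) auto
  then show "\<rho> \<in> (\<lambda>D. spectral_radius (map_mat of_nat D)) ` distance_matrices S"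
    using p(1) by (force simp: distance_matrices_eq)
next
  fix \<sigma> assume "\<sigma> \<in> (\<lambda>D. spectral_radius (map_mat of_nat D)) ` distance_matrices S"
  then obtain p where p: "p \<in> path_choices" "\<sigma> = spectral_radius (map_mat of_nat (path_matrix p))"
    by (auto simp: distance_matrices_eq)
  interpret D: cone_map K "\<lambda>x i. \<Sum>j<K. real (path_matrix p $$ (i, j)) * x j" 1
    by (rule cone_map_positive_matrix[OF K_pos path_matrix_pos[OF p(1)]])
  obtain \<tau> w where w: "0 < \<tau>" "\<And>k. k < K \<Longrightarrow> 0 < w k"
    "\<And>k. k < K \<Longrightarrow> (\<Sum>j<K. real (path_matrix p $$ (k, j)) * w j) = \<tau> * w k"
    using D.ex_eigenvector by blast
  have "\<sigma> = \<tau>"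
    unfolding p(2) using w by (intro spectral_radius_eq_positive_eigenvalue[OF path_matrix_carrier K_pos, of w]) auto
  moreover have "\<rho> \<le> \<tau>"
  proof (rule D.sub_super_eigenvalue_le[of v \<rho> w \<tau>])
    show "\<rho> * v k \<le> (\<Sum>j<K. real (path_matrix p $$ (k, j)) * v j)" if "k < K" for k
      using dist_map_le_matrix[OF p(1) that, of v] v(2)[OF that] by simp
  qed (simp_all add: v(1) w(2,3))
  ultimately show "\<rho> \<le> \<sigma>" by simp
qed

text \<open>Keeps the limiting denominator \<open>ln \<rho>\<close> away from 0. A shortest path
  contains an arc of colour 0 and a further arc: one of colour 1 if there are several colours,
  otherwise one supplied by distance at least 2.\<close>

lemma dist_eigenvalue_gt_1:
  assumes v: "\<And>k. k < K \<Longrightarrow> 0 < v k" "\<And>k. k < K \<Longrightarrow> dist_map v k = \<rho> * v k"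
  shows "1 < \<rho>"
proof -
  obtain p where p: "simple_path (rule S 0) (plant_pos S 0) p (plant_neg S 0)"
    "dist_map v 0 = (\<Sum>e\<in>path_arcs (rule S 0) p. v (ecol S 0 e))"
    using dist_map_attained[OF K_pos] by blast
  let ?P = "path_arcs (rule S 0) p"
  interpret R: sc_graph "rule S 0" by (rule rule_sc[OF K_pos])
  have "v 0 < (\<Sum>e\<in>?P. v (ecol S 0 e))"
  proof (cases "K = 1")
    case True
    have "ecol S 0 e = 0" if "e \<in> ?P" for e
      using path_arcs_colours[OF K_pos, of p] that True by auto
    then have "(\<Sum>e\<in>?P. v (ecol S 0 e)) = card ?P * v 0" by simp
    moreover have "2 \<le> real (card ?P)"
    proof -
      have "walk_cost (rule S 0) (\<lambda>_. 1) (plant_pos S 0) (plant_neg S 0) ?P (card ?P)"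
        using R.simple_path_walk_cost[OF p(1), of "\<lambda>_. 1"] by simp
      from R.graph_dist_le[OF plant(2)[OF K_pos] this] show ?thesis
        using dist_pos True by (simp add: distance_positive_def)
    qed
    ultimately show ?thesis
      using v(1)[OF K_pos] mult_right_mono[of 2 "real (card ?P)" "v 0"] by linarith
  next
    case False
    then have one: "1 < K" using K_pos by simp
    obtain e0 e1 where e: "e0 \<in> ?P" "ecol S 0 e0 = 0" "e1 \<in> ?P" "ecol S 0 e1 = 1"
      using path_colour[OF p(1) K_pos K_pos] path_colour[OF p(1) K_pos one] by blast
    have "v 0 < v 0 + v 1" using v(1)[OF one] by simp
    also have "\<dots> = (\<Sum>e\<in>{e0, e1}. v (ecol S 0 e))" using e by (subst sum.insert) auto
    also have "\<dots> \<le> (\<Sum>e\<in>?P. v (ecol S 0 e))"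
      using e R.finite_path_arcs v(1) path_arcs_colours[OF K_pos, of p]
      by (intro sum_mono2) (auto simp: less_imp_le image_subset_iff)
    finally show ?thesis .
  qed
  then show ?thesis
    using p(2) v[OF K_pos] mult_less_cancel_right_pos[of "v 0" 1 \<rho>] by simp
qed

lemma resistance_dim_limit:
  "has_resistance_dim S (ln (rho_Psi S) / ln (rho_min (distance_matrices S)))"
proof -
  obtain \<rho> v where \<rho>: "0 < \<rho>" "\<And>k. k < K \<Longrightarrow> 0 < v k" "\<And>k. k < K \<Longrightarrow> res_map v k = \<rho> * v k"
    using res.ex_eigenvector by blast
  obtain \<sigma> w where \<sigma>: "0 < \<sigma>" "\<And>k. k < K \<Longrightarrow> 0 < w k" "\<And>k. k < K \<Longrightarrow> dist_map w k = \<sigma> * w k"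
    using dist.ex_eigenvector by blast
  have eqs: "rho_Psi S = \<rho>" "rho_min (distance_matrices S) = \<sigma>"
    using rho_Psi_eq[OF \<rho>] rho_min_eq[OF \<sigma>] by blast+
  have "1 < \<sigma>" by (rule dist_eigenvalue_gt_1[OF \<sigma>(2,3)])
  let ?R = "\<lambda>n. (res_map ^^ n) (\<lambda>_. 1) (init_col S)" and ?d = "\<lambda>n. (dist_map ^^ n) (\<lambda>_. 1) (init_col S)"
  \<comment> \<open>Both logarithms grow linearly, so numerator and denominator are divided by
    \<open>n\<close> before passing to the limit.\<close>
  have "(\<lambda>n. (ln (?R n) / n) / (ln (?d n) / n)) \<longlonglongrightarrow> ln \<rho> / ln \<sigma>"
    using \<open>1 < \<sigma>\<close>
    by (intro tendsto_divide res.funpow_growth[OF \<rho> init_less] dist.funpow_growth[OF \<sigma> init_less]) auto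
  moreover have "\<forall>\<^sub>F n in sequentially. (ln (?R n) / n) / (ln (?d n) / n) = ln (?R n) / ln (?d n)"
    using eventually_gt_at_top[of 0] by eventually_elim simp
  ultimately have "(\<lambda>n. ln (?R n) / ln (?d n)) \<longlonglongrightarrow> ln \<rho> / ln \<sigma>"
    by (rule Lim_transform_eventually)
  then show ?thesis
    unfolding has_resistance_dim_def eqs by (auto simp: eff_res_Xi graph_dist_Xi simp del: Xi.simps(2))
qed

end

text \<open>The initial arc has distinct ends, so the defining condition is not vacuous and the
  \<open>THE\<close> in \<open>resistance_dim\<close> is determined.\<close>

lemma has_resistance_dim_unique:
  assumes "has_resistance_dim S c" "has_resistance_dim S d"
  shows "c = d"
proof -
  let ?f = "\<lambda>n. ln (eff_res (Xi S n) (\<lambda>_. 1) V_pos V_neg) / ln (real (graph_dist (Xi S n) V_pos V_neg))"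
  have "?f \<longlonglongrightarrow> c" "?f \<longlonglongrightarrow> d" using assms unfolding has_resistance_dim_def by simp_all
  then show ?thesis by (rule LIMSEQ_unique)
qed

theorem theorem2p11:
  fixes S :: "('v, 'e) eigs"
  assumes "wf_eigs S"
    and "canonical S"
    and "distance_positive S"
    and "degree_primitive S"
  shows "(\<exists>c. has_resistance_dim S c) \<and>
    resistance_dim S = ln (rho_Psi S) / ln (rho_min (distance_matrices S))"
proof -
  interpret positive_system S using assms by unfold_locales
  show ?thesis
    unfolding resistance_dim_def
    using resistance_dim_limit has_resistance_dim_unique by (blast intro: the_equality)
qed

end
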